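(* Let $\epsilon\in\{-1,1\}$ and let $(M,g,J)$ be a connected $\epsilon$-Kähler manifold of dimension $\dim M\geq 4$ admitting a degenerate homogeneous $\epsilon$-Kähler structure of linear type $S$ with associated vector fields $\xi$ and $\zeta$, and let $\lambda\in\mathbb{R}$ be the constant such that $\zeta=\lambda\xi$. Then the only possible values of $\lambda$ are $\lambda=0$ and $\lambda=-\frac{\epsilon}{2}$.
   Context: Let $\epsilon\in\{-1,1\}$. An $\epsilon$-Kähler manifold $(M,g,J)$ is a pseudo-Riemannian manifold $(M,g)$ of even dimension with a smooth section $J$ of $\mathfrak{so}(TM)$ (i.e. $J$ is $g$-skew-symmetric) such that $J^2=\epsilon\,\mathrm{Id}$ and $\nabla J=0$, $\nabla$ being the Levi-Civita connection. A homogeneous $\epsilon$-Kähler structure is a $(1,2)$-tensor field $S$ such that $\widetilde\nabla=\nabla-S$ satisfies $\widetilde\nabla g=0$, $\widetilde\nabla R=0$, $\widetilde\nabla S=0$, $\widetilde\nabla J=0$, where $R$ is the curvature tensor of $g$. It is of linear type if $$S_XY=g(X,Y)\xi-g(\xi,Y)X+\epsilon g(X,JY)J\xi-\epsilon g(\xi,JY)JX-2g(\zeta,JX)JY$$ for some vector fields $\xi,\zeta$ on $M$; such an $S$ is degenerate if $\xi\neq0$ and $g(\xi,\xi)=0$. It is known that in the degenerate case $\zeta=\lambda\xi$ for some constant $\lambda\in\mathbb{R}$.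
   Formalization: Added hypothesis: at some point Jξ is neither ξ nor −ξ. It is automatic for ε=−1. For ε=1 the claim fails without it: on flat R⁴ with J(a,b)=(a,−b), g((a,b),(c,d))=a·d+b·c, constant ξ=(a,0)≠0 and ζ=−ξ give λ=−1. *)

theory Defs
  imports "HOL-Analysis.Analysis"
begin

section \<open>Smooth maps and smooth manifolds\<close>

text \<open>The derivatives are those of the ambient space; these notions are only used for open \<open>U\<close>.\<close>

primrec Ck_on :: "nat \<Rightarrow> 'a::real_normed_vector set \<Rightarrow> ('a \<Rightarrow> 'b::real_normed_vector) \<Rightarrow> bool" where
  "Ck_on 0 U f \<longleftrightarrow> continuous_on U f"
| "Ck_on (Suc k) U f \<longleftrightarrow>
     (\<forall>x\<in>U. f differentiable (at x)) \<and> (\<forall>v. Ck_on k U (\<lambda>x. frechet_derivative f (at x) v))"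

definition smooth_on :: "'a::real_normed_vector set \<Rightarrow> ('a \<Rightarrow> 'b::real_normed_vector) \<Rightarrow> bool" where
  "smooth_on U f \<longleftrightarrow> (\<forall>k. Ck_on k U f)"

text \<open>
  A chart is a pair of its domain and its coordinate map into the model space \<open>'e\<close>. The dimension
  of a manifold modelled on \<open>'e\<close> is \<open>DIM('e)\<close>.
\<close>

type_synonym ('m, 'e) chart = "'m set \<times> ('m \<Rightarrow> 'e)"

definition chart_image :: "('m, 'e) chart \<Rightarrow> 'e set" where
  "chart_image c = snd c ` fst c"

definition overlap :: "('m, 'e) chart \<Rightarrow> ('m, 'e) chart \<Rightarrow> 'e set" where
  "overlap c d = snd c ` (fst c \<inter> fst d)"

definition transition :: "('m, 'e) chart \<Rightarrow> ('m, 'e) chart \<Rightarrow> 'e \<Rightarrow> 'e" where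
  "transition c d = snd d \<circ> inv_into (fst c) (snd c)"

abbreviation Dtrans ::
  "('m, 'e::euclidean_space) chart \<Rightarrow> ('m, 'e) chart \<Rightarrow> 'e \<Rightarrow> 'e \<Rightarrow> 'e" where
  "Dtrans c d x \<equiv> frechet_derivative (transition c d) (at x)"

definition smooth_manifold :: "'m topology \<Rightarrow> ('m, 'e::euclidean_space) chart set \<Rightarrow> bool" where
  "smooth_manifold M A \<longleftrightarrow>
     Hausdorff_space M \<and> second_countable M \<and>
     (\<Union>c\<in>A. fst c) = topspace M \<and>
     (\<forall>c\<in>A. openin M (fst c) \<and> open (chart_image c) \<and>
        homeomorphic_map (subtopology M (fst c)) (top_of_set (chart_image c)) (snd c)) \<and>
     (\<forall>c\<in>A. \<forall>d\<in>A. smooth_on (overlap c d) (transition c d))"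


section \<open>Tensor fields and connections\<close>

text \<open>
  A tensor field is given by its local representatives: for each chart \<open>c\<close> of the atlas, a
  multilinear-map-valued function on \<open>chart_image c\<close>, such that the representatives in two charts
  correspond under the differential of the transition map. Values at charts outside the atlas and
  at points outside the chart image carry no meaning.
\<close>

definition vector_field ::
  "('m, 'e::euclidean_space) chart set \<Rightarrow> (('m, 'e) chart \<Rightarrow> 'e \<Rightarrow> 'e) \<Rightarrow> bool" where
  "vector_field A X \<longleftrightarrow>
     (\<forall>c\<in>A. smooth_on (chart_image c) (X c)) \<and>
     (\<forall>c\<in>A. \<forall>d\<in>A. \<forall>x\<in>overlap c d. X d (transition c d x) = Dtrans c d x (X c x))"

definition bilinear_form_field ::
  "('m, 'e::euclidean_space) chart set \<Rightarrow> (('m, 'e) chart \<Rightarrow> 'e \<Rightarrow> 'e \<Rightarrow> 'e \<Rightarrow> real) \<Rightarrow> bool" where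
  "bilinear_form_field A g \<longleftrightarrow>
     (\<forall>c\<in>A. \<forall>x\<in>chart_image c. bilinear (g c x)) \<and>
     (\<forall>c\<in>A. \<forall>u v. smooth_on (chart_image c) (\<lambda>x. g c x u v)) \<and>
     (\<forall>c\<in>A. \<forall>d\<in>A. \<forall>x\<in>overlap c d. \<forall>u v.
        g d (transition c d x) (Dtrans c d x u) (Dtrans c d x v) = g c x u v)"

definition endomorphism_field ::
  "('m, 'e::euclidean_space) chart set \<Rightarrow> (('m, 'e) chart \<Rightarrow> 'e \<Rightarrow> 'e \<Rightarrow> 'e) \<Rightarrow> bool" where
  "endomorphism_field A J \<longleftrightarrow>
     (\<forall>c\<in>A. \<forall>x\<in>chart_image c. linear (J c x)) \<and>
     (\<forall>c\<in>A. \<forall>u. smooth_on (chart_image c) (\<lambda>x. J c x u)) \<and>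
     (\<forall>c\<in>A. \<forall>d\<in>A. \<forall>x\<in>overlap c d. \<forall>u.
        J d (transition c d x) (Dtrans c d x u) = Dtrans c d x (J c x u))"

definition tensor_field_1_2 ::
  "('m, 'e::euclidean_space) chart set \<Rightarrow> (('m, 'e) chart \<Rightarrow> 'e \<Rightarrow> 'e \<Rightarrow> 'e \<Rightarrow> 'e) \<Rightarrow> bool" where
  "tensor_field_1_2 A S \<longleftrightarrow>
     (\<forall>c\<in>A. \<forall>x\<in>chart_image c. bilinear (S c x)) \<and>
     (\<forall>c\<in>A. \<forall>u v. smooth_on (chart_image c) (\<lambda>x. S c x u v)) \<and>
     (\<forall>c\<in>A. \<forall>d\<in>A. \<forall>x\<in>overlap c d. \<forall>u v.
        S d (transition c d x) (Dtrans c d x u) (Dtrans c d x v) = Dtrans c d x (S c x u v))"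

text \<open>
  A linear connection is given by its Christoffel maps: in the chart \<open>c\<close>,
  \<open>\<nabla>\<^sub>X Y = DY(X) + \<Gamma>\<^sub>c(X, Y)\<close>. That \<open>\<nabla>\<^sub>X Y\<close> is again a vector field amounts to the law
  \<open>D\<tau>(\<Gamma>\<^sub>c(u,v)) = D\<^sup>2\<tau>(u,v) + \<Gamma>\<^sub>d(D\<tau> u, D\<tau> v)\<close> for the transition map \<open>\<tau>\<close> from \<open>c\<close> to \<open>d\<close>.
\<close>

definition connection ::
  "('m, 'e::euclidean_space) chart set \<Rightarrow> (('m, 'e) chart \<Rightarrow> 'e \<Rightarrow> 'e \<Rightarrow> 'e \<Rightarrow> 'e) \<Rightarrow> bool" where
  "connection A \<Gamma> \<longleftrightarrow>
     (\<forall>c\<in>A. \<forall>x\<in>chart_image c. bilinear (\<Gamma> c x)) \<and>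
     (\<forall>c\<in>A. \<forall>u v. smooth_on (chart_image c) (\<lambda>x. \<Gamma> c x u v)) \<and>
     (\<forall>c\<in>A. \<forall>d\<in>A. \<forall>x\<in>overlap c d. \<forall>u v.
        Dtrans c d x (\<Gamma> c x u v) =
          frechet_derivative (\<lambda>y. Dtrans c d y v) (at x) u +
          \<Gamma> d (transition c d x) (Dtrans c d x u) (Dtrans c d x v))"


section \<open>Covariant derivatives in a chart\<close>

text \<open>
  Below, \<open>\<Gamma>\<close>, \<open>g\<close>, \<open>J\<close>, \<open>S\<close> and \<open>R\<close> are the representatives in one fixed chart, and \<open>X\<close>, \<open>Y\<close>, \<open>Z\<close>,
  \<open>W\<close> are vector fields on its image.
\<close>

definition lie_bracket :: "('e::euclidean_space \<Rightarrow> 'e) \<Rightarrow> ('e \<Rightarrow> 'e) \<Rightarrow> 'e \<Rightarrow> 'e" where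
  "lie_bracket X Y x = frechet_derivative Y (at x) (X x) - frechet_derivative X (at x) (Y x)"

definition cov ::
  "('e::euclidean_space \<Rightarrow> 'e \<Rightarrow> 'e \<Rightarrow> 'e) \<Rightarrow> ('e \<Rightarrow> 'e) \<Rightarrow> ('e \<Rightarrow> 'e) \<Rightarrow> 'e \<Rightarrow> 'e" where
  "cov \<Gamma> X Y x = frechet_derivative Y (at x) (X x) + \<Gamma> x (X x) (Y x)"

definition curvature_operator ::
  "('e::euclidean_space \<Rightarrow> 'e \<Rightarrow> 'e \<Rightarrow> 'e) \<Rightarrow> ('e \<Rightarrow> 'e) \<Rightarrow> ('e \<Rightarrow> 'e) \<Rightarrow> ('e \<Rightarrow> 'e) \<Rightarrow> 'e \<Rightarrow> 'e" where
  "curvature_operator \<Gamma> X Y Z x =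
     cov \<Gamma> X (cov \<Gamma> Y Z) x - cov \<Gamma> Y (cov \<Gamma> X Z) x - cov \<Gamma> (lie_bracket X Y) Z x"

text \<open>The curvature tensor; by tensoriality any extensions of the vectors \<open>u\<close>, \<open>v\<close>, \<open>w\<close> would do.\<close>

definition curvature ::
  "('e::euclidean_space \<Rightarrow> 'e \<Rightarrow> 'e \<Rightarrow> 'e) \<Rightarrow> 'e \<Rightarrow> 'e \<Rightarrow> 'e \<Rightarrow> 'e \<Rightarrow> 'e" where
  "curvature \<Gamma> x u v w = curvature_operator \<Gamma> (\<lambda>_. u) (\<lambda>_. v) (\<lambda>_. w) x"

definition parallel_form ::
  "'e::euclidean_space set \<Rightarrow> ('e \<Rightarrow> 'e \<Rightarrow> 'e \<Rightarrow> 'e) \<Rightarrow> ('e \<Rightarrow> 'e \<Rightarrow> 'e \<Rightarrow> real) \<Rightarrow> bool" where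
  "parallel_form V \<Gamma> g \<longleftrightarrow>
     (\<forall>X Y Z. smooth_on V X \<longrightarrow> smooth_on V Y \<longrightarrow> smooth_on V Z \<longrightarrow> (\<forall>x\<in>V.
        frechet_derivative (\<lambda>y. g y (Y y) (Z y)) (at x) (X x)
        - g x (cov \<Gamma> X Y x) (Z x) - g x (Y x) (cov \<Gamma> X Z x) = 0))"

definition parallel_endomorphism ::
  "'e::euclidean_space set \<Rightarrow> ('e \<Rightarrow> 'e \<Rightarrow> 'e \<Rightarrow> 'e) \<Rightarrow> ('e \<Rightarrow> 'e \<Rightarrow> 'e) \<Rightarrow> bool" where
  "parallel_endomorphism V \<Gamma> J \<longleftrightarrow>
     (\<forall>X Y. smooth_on V X \<longrightarrow> smooth_on V Y \<longrightarrow> (\<forall>x\<in>V.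
        cov \<Gamma> X (\<lambda>y. J y (Y y)) x - J x (cov \<Gamma> X Y x) = 0))"

definition parallel_1_2 ::
  "'e::euclidean_space set \<Rightarrow> ('e \<Rightarrow> 'e \<Rightarrow> 'e \<Rightarrow> 'e) \<Rightarrow> ('e \<Rightarrow> 'e \<Rightarrow> 'e \<Rightarrow> 'e) \<Rightarrow> bool" where
  "parallel_1_2 V \<Gamma> S \<longleftrightarrow>
     (\<forall>X Y Z. smooth_on V X \<longrightarrow> smooth_on V Y \<longrightarrow> smooth_on V Z \<longrightarrow> (\<forall>x\<in>V.
        cov \<Gamma> X (\<lambda>y. S y (Y y) (Z y)) x
        - S x (cov \<Gamma> X Y x) (Z x) - S x (Y x) (cov \<Gamma> X Z x) = 0))"

definition parallel_1_3 ::
  "'e::euclidean_space set \<Rightarrow> ('e \<Rightarrow> 'e \<Rightarrow> 'e \<Rightarrow> 'e) \<Rightarrow> ('e \<Rightarrow> 'e \<Rightarrow> 'e \<Rightarrow> 'e \<Rightarrow> 'e) \<Rightarrow> bool" where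
  "parallel_1_3 V \<Gamma> R \<longleftrightarrow>
     (\<forall>X Y Z W. smooth_on V X \<longrightarrow> smooth_on V Y \<longrightarrow> smooth_on V Z \<longrightarrow> smooth_on V W \<longrightarrow> (\<forall>x\<in>V.
        cov \<Gamma> X (\<lambda>y. R y (Y y) (Z y) (W y)) x
        - R x (cov \<Gamma> X Y x) (Z x) (W x) - R x (Y x) (cov \<Gamma> X Z x) (W x)
        - R x (Y x) (Z x) (cov \<Gamma> X W x) = 0))"

definition torsion_free ::
  "'e::euclidean_space set \<Rightarrow> ('e \<Rightarrow> 'e \<Rightarrow> 'e \<Rightarrow> 'e) \<Rightarrow> bool" where
  "torsion_free V \<Gamma> \<longleftrightarrow>
     (\<forall>X Y. smooth_on V X \<longrightarrow> smooth_on V Y \<longrightarrow> (\<forall>x\<in>V.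
        cov \<Gamma> X Y x - cov \<Gamma> Y X x = lie_bracket X Y x))"


section \<open>Homogeneous \<open>\<epsilon>\<close>-Kaehler structures\<close>

definition pseudo_riemannian ::
  "'m topology \<Rightarrow> ('m, 'e::euclidean_space) chart set \<Rightarrow>
   (('m, 'e) chart \<Rightarrow> 'e \<Rightarrow> 'e \<Rightarrow> 'e \<Rightarrow> real) \<Rightarrow> bool" where
  "pseudo_riemannian M A g \<longleftrightarrow>
     smooth_manifold M A \<and> bilinear_form_field A g \<and>
     (\<forall>c\<in>A. \<forall>x\<in>chart_image c.
        (\<forall>u v. g c x u v = g c x v u) \<and> (\<forall>u. (\<forall>v. g c x u v = 0) \<longrightarrow> u = 0))"

definition levi_civita ::
  "('m, 'e::euclidean_space) chart set \<Rightarrow> (('m, 'e) chart \<Rightarrow> 'e \<Rightarrow> 'e \<Rightarrow> 'e \<Rightarrow> real) \<Rightarrow>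
   (('m, 'e) chart \<Rightarrow> 'e \<Rightarrow> 'e \<Rightarrow> 'e \<Rightarrow> 'e) \<Rightarrow> bool" where
  "levi_civita A g \<Gamma> \<longleftrightarrow>
     connection A \<Gamma> \<and>
     (\<forall>c\<in>A. torsion_free (chart_image c) (\<Gamma> c) \<and> parallel_form (chart_image c) (\<Gamma> c) (g c))"

definition eps_kaehler ::
  "real \<Rightarrow> 'm topology \<Rightarrow> ('m, 'e::euclidean_space) chart set \<Rightarrow>
   (('m, 'e) chart \<Rightarrow> 'e \<Rightarrow> 'e \<Rightarrow> 'e \<Rightarrow> real) \<Rightarrow> (('m, 'e) chart \<Rightarrow> 'e \<Rightarrow> 'e \<Rightarrow> 'e) \<Rightarrow>
   (('m, 'e) chart \<Rightarrow> 'e \<Rightarrow> 'e \<Rightarrow> 'e \<Rightarrow> 'e) \<Rightarrow> bool" where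
  "eps_kaehler \<epsilon> M A g J \<Gamma> \<longleftrightarrow>
     pseudo_riemannian M A g \<and> even DIM('e) \<and> levi_civita A g \<Gamma> \<and> endomorphism_field A J \<and>
     (\<forall>c\<in>A. \<forall>x\<in>chart_image c.
        (\<forall>u v. g c x (J c x u) v = - g c x u (J c x v)) \<and> (\<forall>u. J c x (J c x u) = \<epsilon> *\<^sub>R u)) \<and>
     (\<forall>c\<in>A. parallel_endomorphism (chart_image c) (\<Gamma> c) (J c))"

text \<open>
  \<open>\<Gamma>\<close> is the Levi-Civita connection, so \<open>\<Gamma> - S\<close> represents the connection \<open>\<nabla> - S\<close>, while the
  curvature is that of \<open>\<Gamma>\<close>.
\<close>

definition homogeneous_eps_kaehler_structure ::
  "('m, 'e::euclidean_space) chart set \<Rightarrow> (('m, 'e) chart \<Rightarrow> 'e \<Rightarrow> 'e \<Rightarrow> 'e \<Rightarrow> real) \<Rightarrow>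
   (('m, 'e) chart \<Rightarrow> 'e \<Rightarrow> 'e \<Rightarrow> 'e) \<Rightarrow> (('m, 'e) chart \<Rightarrow> 'e \<Rightarrow> 'e \<Rightarrow> 'e \<Rightarrow> 'e) \<Rightarrow>
   (('m, 'e) chart \<Rightarrow> 'e \<Rightarrow> 'e \<Rightarrow> 'e \<Rightarrow> 'e) \<Rightarrow> bool" where
  "homogeneous_eps_kaehler_structure A g J \<Gamma> S \<longleftrightarrow>
     tensor_field_1_2 A S \<and>
     (\<forall>c\<in>A. let V = chart_image c; \<Gamma>' = (\<lambda>x u v. \<Gamma> c x u v - S c x u v) in
        parallel_form V \<Gamma>' (g c) \<and> parallel_1_3 V \<Gamma>' (curvature (\<Gamma> c)) \<and>
        parallel_1_2 V \<Gamma>' (S c) \<and> parallel_endomorphism V \<Gamma>' (J c))"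

definition linear_type ::
  "real \<Rightarrow> ('m, 'e::euclidean_space) chart set \<Rightarrow> (('m, 'e) chart \<Rightarrow> 'e \<Rightarrow> 'e \<Rightarrow> 'e \<Rightarrow> real) \<Rightarrow>
   (('m, 'e) chart \<Rightarrow> 'e \<Rightarrow> 'e \<Rightarrow> 'e) \<Rightarrow> (('m, 'e) chart \<Rightarrow> 'e \<Rightarrow> 'e \<Rightarrow> 'e \<Rightarrow> 'e) \<Rightarrow>
   (('m, 'e) chart \<Rightarrow> 'e \<Rightarrow> 'e) \<Rightarrow> (('m, 'e) chart \<Rightarrow> 'e \<Rightarrow> 'e) \<Rightarrow> bool" where
  "linear_type \<epsilon> A g J S \<xi> \<zeta> \<longleftrightarrow>
     vector_field A \<xi> \<and> vector_field A \<zeta> \<and>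
     (\<forall>c\<in>A. \<forall>x\<in>chart_image c. \<forall>u v. let G = g c x; I = J c x; a = \<xi> c x; b = \<zeta> c x in
        S c x u v = G u v *\<^sub>R a - G a v *\<^sub>R u + (\<epsilon> * G u (I v)) *\<^sub>R I a - (\<epsilon> * G a (I v)) *\<^sub>R I u
                    - (2 * G b (I u)) *\<^sub>R I v)"

definition degenerate ::
  "('m, 'e::euclidean_space) chart set \<Rightarrow> (('m, 'e) chart \<Rightarrow> 'e \<Rightarrow> 'e \<Rightarrow> 'e \<Rightarrow> real) \<Rightarrow>
   (('m, 'e) chart \<Rightarrow> 'e \<Rightarrow> 'e) \<Rightarrow> bool" where
  "degenerate A g \<xi> \<longleftrightarrow>
     (\<exists>c\<in>A. \<exists>x\<in>chart_image c. \<xi> c x \<noteq> 0) \<and>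
     (\<forall>c\<in>A. \<forall>x\<in>chart_image c. g c x (\<xi> c x) (\<xi> c x) = 0)"

text \<open>
  For \<open>\<epsilon> = 1\<close> a null field \<open>\<xi>\<close> may consist of eigenvectors of \<open>J\<close>, i.e. \<open>J\<xi> = \<xi>\<close> or \<open>J\<xi> = -\<xi>\<close>.
  This case has to be excluded in the theorem: on flat \<open>\<real>\<^sup>4 = \<real>\<^sup>2 \<times> \<real>\<^sup>2\<close> with \<open>J(a,b) = (a,-b)\<close> and
  \<open>g((a,b),(c,d)) = a \<bullet> d + b \<bullet> c\<close>, a constant \<open>\<xi> = (a,0) \<noteq> 0\<close> with \<open>\<zeta> = -\<xi>\<close> defines a degenerate
  homogeneous structure of linear type, so that \<open>\<lambda> = -1\<close> occurs. For \<open>\<epsilon> = -1\<close> there are no real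
  eigenvectors, and nothing is excluded when \<open>\<xi> \<noteq> 0\<close>.
\<close>

definition J_eigenfield ::
  "('m, 'e::euclidean_space) chart set \<Rightarrow> (('m, 'e) chart \<Rightarrow> 'e \<Rightarrow> 'e \<Rightarrow> 'e) \<Rightarrow>
   (('m, 'e) chart \<Rightarrow> 'e \<Rightarrow> 'e) \<Rightarrow> bool" where
  "J_eigenfield A J \<xi> \<longleftrightarrow>
     (\<forall>c\<in>A. \<forall>x\<in>chart_image c. J c x (\<xi> c x) = \<xi> c x \<or> J c x (\<xi> c x) = - \<xi> c x)"

end

(*
  Put theta = g(xi, .), phi = g(J xi, .), F = theta /\ phi and k = eps + 2 lambda, and suppose k is
  nonzero. Where F does not vanish, i.e. xi and J xi are independent, the condition that S is
  parallel for nabla - S forces xi to be parallel for it, so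
    nabla_X xi = S_X xi = theta(X) xi + k phi(X) J xi,
  and differentiating once more gives R(X,Y) xi = c F(X,Y) J xi with c = -2 lambda eps k.
  By pair symmetry this determines R(xi, .) and R(J xi, .). Since S_xi = 0 and nabla R = S.R, the
  second Bianchi identity with xi as one of its arguments reduces to c F(Y,Z) F(W,U) = 0.
  Hence c = 0, that is lambda = 0 or k = 0.
*)
theory Submission
  imports Defs
begin

section \<open>Calculus of smooth maps\<close>

text \<open>Since lambda is a constant, one point where \<xi> and J\<xi> are independent decides its
  value, and the whole argument stays in a chart around that point. Independence at the point alone
  is not enough: R(X,Y) \<xi> needs the formula for nabla \<xi> on a neighbourhood, which is
  available because F is continuous and so F \<noteq> 0 is an open condition.

  The assumption that k is nonzero enters when parallelism of S is turned into parallelism of \<xi>.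
  If b is the derivative of \<xi> for nabla - S, the tensor of linear type built from b vanishes;
  its value at (\<xi>, \<xi>) is -k phi(b) J\<xi>, whence phi(b) = 0.

  The constant c arises as k (1 - k eps). The formula for nabla \<xi> makes theta closed and gives d
  phi = (1 - k eps) F, and the curvature on \<xi> is k d phi times J\<xi>. Finally 1 - k eps = -2
  lambda eps because eps^2 = 1.\<close>

lemma frechet_derivative_eqI: "(f has_derivative f') (at x) \<Longrightarrow> frechet_derivative f (at x) = f'"
  by (metis frechet_derivative_at)

lemma differentiable_has_derivative:
  "f differentiable at x \<Longrightarrow> (f has_derivative frechet_derivative f (at x)) (at x)"
  by (simp add: frechet_derivative_works)

text \<open>Both maps have the same derivatives at \<open>x\<close>, and
  \<open>frechet_derivative\<close> chooses by that predicate alone, so the equality also holds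
  where neither map is differentiable.\<close>

lemma frechet_derivative_cong_open:
  assumes "open U" "x \<in> U" "\<And>y. y \<in> U \<Longrightarrow> f y = g y"
  shows "frechet_derivative f (at x) = frechet_derivative g (at x)"
proof -
  have "(f has_derivative D) (at x) \<longleftrightarrow> (g has_derivative D) (at x)" for D
    using has_derivative_transform_within_open[OF _ assms(1,2), of f D UNIV g]
      has_derivative_transform_within_open[OF _ assms(1,2), of g D UNIV f] assms(3) by auto
  then show ?thesis by (simp add: frechet_derivative_def)
qed

lemma Ck_on_cong_open:
  assumes "open U" "\<And>y. y \<in> U \<Longrightarrow> f y = g y" "Ck_on k U f"
  shows "Ck_on k U g"
  using assms(2,3)
proof (induction k arbitrary: f g)
  case 0
  then show ?case using continuous_on_cong[of U U f g] by simp
next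
  case (Suc k)
  have 1: "g differentiable at x" if "x \<in> U" for x
    using Suc.prems has_derivative_transform_within_open[OF _ assms(1) that, of f _ UNIV g] that
    unfolding Ck_on.simps differentiable_def by metis
  have 2: "Ck_on k U (\<lambda>x. frechet_derivative g (at x) v)" for v
    by (rule Suc.IH[of "\<lambda>x. frechet_derivative f (at x) v"])
      (use Suc.prems frechet_derivative_cong_open[OF assms(1) _ Suc.prems(1)] in simp_all)
  show ?case using 1 2 by simp
qed

lemma Ck_on_SucD: "Ck_on (Suc k) U f \<Longrightarrow> Ck_on k U f"
proof (induction k arbitrary: f)
  case 0
  then show ?case
    by (auto simp: continuous_at_imp_continuous_on differentiable_imp_continuous_within)
next
  case (Suc k)
  have "f differentiable at x" if "x \<in> U" for x using Suc.prems that by simp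
  moreover have "Ck_on k U (\<lambda>x. frechet_derivative f (at x) v)" for v
    by (rule Suc.IH) (use Suc.prems in simp)
  ultimately show ?case by simp
qed

lemma Ck_on_const: "Ck_on k U (\<lambda>x. c)"
  by (induction k arbitrary: c) auto

lemma Ck_on_add:
  assumes "open U" "Ck_on k U f" "Ck_on k U g"
  shows "Ck_on k U (\<lambda>x. f x + g x)"
  using assms(2,3)
proof (induction k arbitrary: f g)
  case 0
  then show ?case by (simp add: continuous_on_add)
next
  case (Suc k)
  have "Ck_on k U (\<lambda>x. frechet_derivative (\<lambda>x. f x + g x) (at x) v)" for v
  proof (rule Ck_on_cong_open[OF assms(1)])
    show "Ck_on k U (\<lambda>x. frechet_derivative f (at x) v + frechet_derivative g (at x) v)"
      using Suc by simp
    show "frechet_derivative f (at x) v + frechet_derivative g (at x) v =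
        frechet_derivative (\<lambda>x. f x + g x) (at x) v" if "x \<in> U" for x
      using Suc.prems that by (simp add: frechet_derivative_eqI[OF has_derivative_add[OF
            differentiable_has_derivative differentiable_has_derivative]])
  qed
  with Suc.prems show ?case by simp
qed

lemma Ck_on_bilinear:
  assumes "open U" "bounded_bilinear pr" "Ck_on k U f" "Ck_on k U g"
  shows "Ck_on k U (\<lambda>x. pr (f x) (g x))"
  using assms(3,4)
proof (induction k arbitrary: f g)
  case 0
  then show ?case by (simp add: bounded_bilinear.continuous_on[OF assms(2)])
next
  case (Suc k)
  have D: "((\<lambda>x. pr (f x) (g x)) has_derivative
      (\<lambda>v. pr (f x) (frechet_derivative g (at x) v) + pr (frechet_derivative f (at x) v) (g x))) (at x)"
    if "x \<in> U" for x
    using Suc.prems that bounded_bilinear.FDERIV[OF assms(2), of f _ x UNIV g]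
    by (simp add: differentiable_has_derivative)
  have "Ck_on k U (\<lambda>x. frechet_derivative (\<lambda>x. pr (f x) (g x)) (at x) v)" for v
  proof (rule Ck_on_cong_open[OF assms(1)])
    \<comment> \<open>Each summand of the product rule keeps one factor undifferentiated; that
      factor is used with one order of smoothness less than it has.\<close>
    show "Ck_on k U (\<lambda>x. pr (f x) (frechet_derivative g (at x) v) + pr (frechet_derivative f (at x) v) (g x))"
      using Suc Ck_on_SucD[of k U f] Ck_on_SucD[of k U g] by (intro Ck_on_add[OF assms(1)] Suc.IH) simp_all
  qed (simp add: frechet_derivative_eqI[OF D])
  with D show ?case by (auto simp: differentiable_def)
qed

lemma smooth_on_const: "smooth_on U (\<lambda>x. c)"
  by (simp add: smooth_on_def Ck_on_const)

lemma smooth_on_add: "open U \<Longrightarrow> smooth_on U f \<Longrightarrow> smooth_on U g \<Longrightarrow> smooth_on U (\<lambda>x. f x + g x)"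
  by (simp add: smooth_on_def Ck_on_add)

lemma smooth_on_bilinear:
  "open U \<Longrightarrow> bounded_bilinear pr \<Longrightarrow> smooth_on U f \<Longrightarrow> smooth_on U g \<Longrightarrow> smooth_on U (\<lambda>x. pr (f x) (g x))"
  by (simp add: smooth_on_def Ck_on_bilinear)

lemmas smooth_on_scaleR = smooth_on_bilinear[OF _ bounded_bilinear_scaleR]
lemmas smooth_on_inner = smooth_on_bilinear[OF _ bounded_bilinear_inner]

lemma smooth_on_diff:
  "open U \<Longrightarrow> smooth_on U f \<Longrightarrow> smooth_on U g \<Longrightarrow> smooth_on U (\<lambda>x. f x - g x)"
  using smooth_on_add[of U f "\<lambda>x. (-1) *\<^sub>R g x"] smooth_on_scaleR[of U "\<lambda>_. -1" g]
  by (simp add: smooth_on_const)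

lemma smooth_on_sum:
  "open U \<Longrightarrow> (\<And>i. i \<in> I \<Longrightarrow> smooth_on U (f i)) \<Longrightarrow> smooth_on U (\<lambda>x. \<Sum>i\<in>I. f i x)"
  by (induction I rule: infinite_finite_induct) (simp_all add: smooth_on_const smooth_on_add)

lemma smooth_on_cong_open:
  "open U \<Longrightarrow> smooth_on U f \<Longrightarrow> (\<And>y. y \<in> U \<Longrightarrow> f y = g y) \<Longrightarrow> smooth_on U g"
  unfolding smooth_on_def using Ck_on_cong_open by blast

lemma smooth_on_frechet_derivative:
  "smooth_on U f \<Longrightarrow> smooth_on U (\<lambda>x. frechet_derivative f (at x) v)"
  unfolding smooth_on_def by (metis Ck_on.simps(2))

lemma smooth_on_has_derivative:
  "smooth_on U f \<Longrightarrow> x \<in> U \<Longrightarrow> (f has_derivative frechet_derivative f (at x)) (at x)"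
  unfolding smooth_on_def by (metis Ck_on.simps(2) differentiable_has_derivative)

lemma smooth_on_continuous_on: "smooth_on U f \<Longrightarrow> continuous_on U f"
  unfolding smooth_on_def by (metis Ck_on.simps(1))

text \<open>The mean value theorem is applied in direction \<open>u\<close> to the increment of
  \<open>f\<close> along \<open>h *\<^sub>R v\<close>, then in direction \<open>v\<close> to the
  resulting first derivative. The second difference is symmetric in \<open>u\<close> and
  \<open>v\<close>, while the right-hand side differentiates in a fixed order; the symmetry of
  second derivatives comes from this contrast.\<close>

lemma second_difference_mean_value:
  fixes f :: "'a::real_normed_vector \<Rightarrow> real"
  assumes f: "smooth_on U f" and h: "0 < h"
    and U: "\<And>s t. s \<in> {0..h} \<Longrightarrow> t \<in> {0..h} \<Longrightarrow> x + s *\<^sub>R u + t *\<^sub>R v \<in> U"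
  shows "\<exists>s\<in>{0..h}. \<exists>t\<in>{0..h}.
    f (x + h *\<^sub>R u + h *\<^sub>R v) - f (x + h *\<^sub>R u) - f (x + h *\<^sub>R v) + f x =
    h * h * frechet_derivative (\<lambda>y. frechet_derivative f (at y) u) (at (x + s *\<^sub>R u + t *\<^sub>R v)) v"
proof -
  have lin: "frechet_derivative k (at y) (r *\<^sub>R w) = r * frechet_derivative k (at y) w"
    if "smooth_on U k" "y \<in> U" for k :: "'a \<Rightarrow> real" and y w r
    using has_derivative_linear[OF smooth_on_has_derivative[OF that]] by (simp add: linear_cmul)
  have line: "((\<lambda>r. k (a + r *\<^sub>R w)) has_real_derivative frechet_derivative k (at (a + r *\<^sub>R w)) w) (at r)"
    if k: "smooth_on U k" and y: "a + r *\<^sub>R w \<in> U" for k a w r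
    unfolding has_field_derivative_def
    by (rule has_derivative_eq_rhs[OF has_derivative_compose[where f = "\<lambda>r. a + r *\<^sub>R w", OF _ smooth_on_has_derivative[OF k y]]])
      (auto intro!: derivative_eq_intros simp: lin[OF k y])
  define \<phi> where "\<phi> r = f ((x + h *\<^sub>R v) + r *\<^sub>R u) - f (x + r *\<^sub>R u)" for r
  define \<phi>' where "\<phi>' r = frechet_derivative f (at ((x + h *\<^sub>R v) + r *\<^sub>R u)) u
    - frechet_derivative f (at (x + r *\<^sub>R u)) u" for r
  have "(\<phi> has_real_derivative \<phi>' r) (at r)" if "r \<in> {0..h}" for r
    unfolding \<phi>_def \<phi>'_def using U[OF that, of h] U[OF that, of 0] h
    by (intro DERIV_diff line f) (simp_all add: ac_simps)
  then obtain s where s: "0 < s" "s < h" "\<phi> h - \<phi> 0 = (h - 0) * \<phi>' s"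
    using MVT2[OF h, of \<phi> \<phi>'] by auto
  define \<psi> where "\<psi> r = frechet_derivative f (at (x + s *\<^sub>R u + r *\<^sub>R v)) u" for r
  define \<psi>' where "\<psi>' r = frechet_derivative (\<lambda>y. frechet_derivative f (at y) u) (at (x + s *\<^sub>R u + r *\<^sub>R v)) v" for r
  have "(\<psi> has_real_derivative \<psi>' r) (at r)" if "r \<in> {0..h}" for r
    unfolding \<psi>_def \<psi>'_def using U[OF _ that, of s] s
    by (intro line smooth_on_frechet_derivative f) simp_all
  then obtain t where t: "0 < t" "t < h" "\<psi> h - \<psi> 0 = (h - 0) * \<psi>' t"
    using MVT2[OF h, of \<psi> \<psi>'] by auto
  have "\<phi>' s = \<psi> h - \<psi> 0" by (simp add: \<phi>'_def \<psi>_def ac_simps)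
  with s t have "\<phi> h - \<phi> 0 = h * h * \<psi>' t" by simp
  moreover have "\<phi> h - \<phi> 0 = f (x + h *\<^sub>R u + h *\<^sub>R v) - f (x + h *\<^sub>R u) - f (x + h *\<^sub>R v) + f x"
    by (simp add: \<phi>_def ac_simps)
  ultimately show ?thesis using s t unfolding \<psi>'_def by (metis atLeastAtMost_iff less_imp_le)
qed

text \<open>Writing one second difference in both orders makes the two mixed derivatives agree at
  two points of a small parallelogram at \<open>x\<close>. By continuity they cannot differ at
  \<open>x\<close>.\<close>

lemma symmetric_second_derivative_real:
  fixes f :: "'a::real_normed_vector \<Rightarrow> real"
  assumes "open U" and f: "smooth_on U f" and x: "x \<in> U"
  shows "frechet_derivative (\<lambda>y. frechet_derivative f (at y) u) (at x) v =
    frechet_derivative (\<lambda>y. frechet_derivative f (at y) v) (at x) u" (is "?A x = ?B x")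
proof (rule ccontr)
  assume ne: "?A x \<noteq> ?B x"
  \<comment> \<open>Half the gap: values within \<open>e\<close> of \<open>?A x\<close> and of
    \<open>?B x\<close> cannot coincide.\<close>
  define e where "e = \<bar>?A x - ?B x\<bar> / 2"
  have e: "e > 0" using ne by (simp add: e_def)
  have cont: "isCont (\<lambda>y. frechet_derivative (\<lambda>y. frechet_derivative f (at y) a) (at y) b) x" for a b
    using smooth_on_continuous_on[OF smooth_on_frechet_derivative[OF smooth_on_frechet_derivative[OF f]]]
      continuous_on_eq_continuous_at[OF assms(1)] x by blast
  have nbhd: "\<exists>d>0. \<forall>y. dist y x < d \<longrightarrow> dist (k y) (k x) < e" if "isCont k x" for k :: "'a \<Rightarrow> real"
    using that e unfolding continuous_at_eps_delta by blast
  obtain d1 where d1: "d1 > 0" "\<And>y. dist y x < d1 \<Longrightarrow> dist (?A y) (?A x) < e"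
    using nbhd[OF cont[of u v]] by blast
  obtain d2 where d2: "d2 > 0" "\<And>y. dist y x < d2 \<Longrightarrow> dist (?B y) (?B x) < e"
    using nbhd[OF cont[of v u]] by blast
  obtain d3 where d3: "d3 > 0" "\<And>y. dist y x < d3 \<Longrightarrow> y \<in> U"
    using x assms(1) unfolding open_dist by blast
  define d where "d = min d1 (min d2 d3)"
  have d: "d > 0" using d1(1) d2(1) d3(1) by (simp add: d_def)
  have near: "y \<in> U \<and> dist (?A y) (?A x) < e \<and> dist (?B y) (?B x) < e" if "dist y x < d" for y
    using that unfolding d_def min_less_iff_conj by (intro conjI d1 d2 d3) simp_all
  \<comment> \<open>The summand 1 keeps \<open>n\<close> positive when \<open>u = v = 0\<close>;
    \<open>h\<close> is then small enough for the parallelogram to stay within distance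
    \<open>d / 2\<close> of \<open>x\<close>.\<close>
  define n where "n = norm u + norm v + 1"
  have n: "n > 0" by (simp add: n_def add_nonneg_pos)
  define h where "h = d / (2 * n)"
  have h: "h > 0" unfolding h_def using d n by simp
  have close: "dist (x + s *\<^sub>R a + t *\<^sub>R b) x < d"
    if "s \<in> {0..h}" "t \<in> {0..h}" "norm a + norm b = norm u + norm v" for s t a b
  proof -
    have "norm (s *\<^sub>R a + t *\<^sub>R b) \<le> s * norm a + t * norm b"
      using norm_triangle_ineq[of "s *\<^sub>R a" "t *\<^sub>R b"] that by simp
    also have "\<dots> \<le> h * norm a + h * norm b" using that by (intro add_mono mult_right_mono) auto
    also have "\<dots> = h * (norm u + norm v)" using that(3) by (metis distrib_left)
    also have "\<dots> \<le> h * n" using h by (simp add: n_def)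
    also have "\<dots> = d / 2" using n by (simp add: h_def)
    finally show ?thesis using d by (simp add: dist_norm add.assoc)
  qed
  have "x + s *\<^sub>R u + t *\<^sub>R v \<in> U" "x + s *\<^sub>R v + t *\<^sub>R u \<in> U" if "s \<in> {0..h}" "t \<in> {0..h}" for s t
    using near close[OF that, of u v] close[OF that, of v u] by auto
  then obtain s t s' t' where st: "s \<in> {0..h}" "t \<in> {0..h}" "s' \<in> {0..h}" "t' \<in> {0..h}"
    and "h * h * ?A (x + s *\<^sub>R u + t *\<^sub>R v) = h * h * ?B (x + s' *\<^sub>R v + t' *\<^sub>R u)"
    using second_difference_mean_value[OF f h, of x u v] second_difference_mean_value[OF f h, of x v u]
    by (smt (verit) add.commute add.left_commute)
  then have "?A (x + s *\<^sub>R u + t *\<^sub>R v) = ?B (x + s' *\<^sub>R v + t' *\<^sub>R u)" using h by simp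
  moreover have "dist (?A (x + s *\<^sub>R u + t *\<^sub>R v)) (?A x) < e" "dist (?B (x + s' *\<^sub>R v + t' *\<^sub>R u)) (?B x) < e"
    using near close[OF st(1,2), of u v] close[OF st(3,4), of v u] by auto
  ultimately show False unfolding e_def dist_real_def by (simp add: abs_if split: if_splits)
qed

text \<open>The mean value theorem with equality needs real values, so the claim is tested against
  each fixed \<open>w\<close>; pairing with \<open>w\<close> commutes with differentiation.\<close>

lemma symmetric_second_derivative:
  fixes f :: "'a::real_normed_vector \<Rightarrow> 'b::real_inner"
  assumes "open U" and f: "smooth_on U f" and x: "x \<in> U"
  shows "frechet_derivative (\<lambda>y. frechet_derivative f (at y) u) (at x) v =
    frechet_derivative (\<lambda>y. frechet_derivative f (at y) v) (at x) u"
proof -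
  have inner: "frechet_derivative (\<lambda>y. k y \<bullet> w) (at y) z = frechet_derivative k (at y) z \<bullet> w"
    if "smooth_on U k" "y \<in> U" for k :: "'a \<Rightarrow> 'b" and y z w
    by (rule fun_cong[OF frechet_derivative_eqI])
      (rule has_derivative_inner_left[OF smooth_on_has_derivative[OF that]])
  have "frechet_derivative (\<lambda>y. frechet_derivative f (at y) a) (at x) b \<bullet> w =
      frechet_derivative (\<lambda>y. frechet_derivative (\<lambda>y. f y \<bullet> w) (at y) a) (at x) b" for a b w
    by (subst inner[symmetric, OF smooth_on_frechet_derivative[OF f] x],
        rule fun_cong[OF frechet_derivative_cong_open[OF assms(1) x]]) (simp add: inner[OF f])
  then have "frechet_derivative (\<lambda>y. frechet_derivative f (at y) u) (at x) v \<bullet> w =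
      frechet_derivative (\<lambda>y. frechet_derivative f (at y) v) (at x) u \<bullet> w" for w
    by (simp add: symmetric_second_derivative_real[OF assms(1) _ x] smooth_on_inner[OF assms(1) f] smooth_on_const)
  then show ?thesis by (metis vector_eq_rdot)
qed

section \<open>Curvature of a connection in a chart\<close>

lemma frechet_derivative_smooth_add:
  assumes "smooth_on U f" "smooth_on U g" "x \<in> U"
  shows "frechet_derivative (\<lambda>y. f y + g y) (at x) h =
    frechet_derivative f (at x) h + frechet_derivative g (at x) h"
  by (rule fun_cong[OF frechet_derivative_eqI])
    (rule has_derivative_add[OF assms(1,2)[THEN smooth_on_has_derivative, OF assms(3)]])

section \<open>Families of linear and bilinear maps evaluated on fields\<close>

lemma linear_basis_expansion:
  fixes L :: "'a::euclidean_space \<Rightarrow> 'b::real_vector"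
  assumes "linear L"
  shows "L w = (\<Sum>b\<in>Basis. (w \<bullet> b) *\<^sub>R L b)"
  by (subst euclidean_representation[of w, symmetric]) (simp only: linear_sum[OF assms] linear_cmul[OF assms])

text \<open>Tensor fields are given as smooth on fixed vectors only; expanding a variable argument
  in the basis reduces to finitely many of these functions.\<close>

lemma smooth_on_linear_family:
  fixes Y :: "'a::real_normed_vector \<Rightarrow> 'e::euclidean_space"
  assumes "open V" and lin: "\<And>y. y \<in> V \<Longrightarrow> linear (L y)"
    and L: "\<And>u. smooth_on V (\<lambda>y. L y u)" and Y: "smooth_on V Y"
  shows "smooth_on V (\<lambda>y. L y (Y y))"
proof (rule smooth_on_cong_open[OF assms(1)])
  show "smooth_on V (\<lambda>y. \<Sum>b\<in>Basis. (Y y \<bullet> b) *\<^sub>R L y b)"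
    using assms by (intro smooth_on_sum smooth_on_scaleR smooth_on_inner smooth_on_const)
qed (simp add: linear_basis_expansion[OF lin, symmetric])

lemma frechet_derivative_linear_family:
  fixes Y :: "'a::real_normed_vector \<Rightarrow> 'e::euclidean_space"
  assumes "open V" and lin: "\<And>y. y \<in> V \<Longrightarrow> linear (L y)"
    and L: "\<And>u. smooth_on V (\<lambda>y. L y u)" and Y: "smooth_on V Y" and x: "x \<in> V"
  shows "frechet_derivative (\<lambda>y. L y (Y y)) (at x) h =
    frechet_derivative (\<lambda>y. L y (Y x)) (at x) h + L x (frechet_derivative Y (at x) h)"
proof -
  \<comment> \<open>Stated for any \<open>Z\<close> so that it serves twice: with the constant field
    \<open>Y x\<close> and with \<open>Y\<close> itself. The claim compares the two results.\<close>
  have D: "frechet_derivative (\<lambda>y. L y (Z y)) (at x) =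
      (\<lambda>h. \<Sum>b\<in>Basis. (Z x \<bullet> b) *\<^sub>R frechet_derivative (\<lambda>y. L y b) (at x) h
        + (Z' h \<bullet> b) *\<^sub>R L x b)" if Z: "(Z has_derivative Z') (at x)" for Z Z'
  proof (rule frechet_derivative_eqI)
    have "((\<lambda>y. \<Sum>b\<in>Basis. (Z y \<bullet> b) *\<^sub>R L y b) has_derivative
      (\<lambda>h. \<Sum>b\<in>Basis. (Z x \<bullet> b) *\<^sub>R frechet_derivative (\<lambda>y. L y b) (at x) h
        + (Z' h \<bullet> b) *\<^sub>R L x b)) (at x)"
      by (intro has_derivative_sum has_derivative_scaleR has_derivative_inner_left
          smooth_on_has_derivative[OF L x] Z)
    then show "((\<lambda>y. L y (Z y)) has_derivative
      (\<lambda>h. \<Sum>b\<in>Basis. (Z x \<bullet> b) *\<^sub>R frechet_derivative (\<lambda>y. L y b) (at x) h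
        + (Z' h \<bullet> b) *\<^sub>R L x b)) (at x)"
      by (rule has_derivative_transform_within_open[OF _ assms(1) x])
        (simp add: linear_basis_expansion[OF lin, symmetric])
  qed
  show ?thesis
    using D[OF has_derivative_const, of "Y x"] D[OF smooth_on_has_derivative[OF Y x]]
    by (simp add: sum.distrib linear_basis_expansion[OF lin[OF x], symmetric])
qed

lemma linear_frechet_derivative_family:
  assumes "open V" and lin: "\<And>y. y \<in> V \<Longrightarrow> linear (L y)"
    and L: "\<And>u. smooth_on V (\<lambda>y. L y u)" and x: "x \<in> V"
  shows "linear (\<lambda>u. frechet_derivative (\<lambda>y. L y u) (at x) h)"
proof (rule linearI)
  note D = smooth_on_has_derivative[OF L x]
  show "frechet_derivative (\<lambda>y. L y (a + b)) (at x) h =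
      frechet_derivative (\<lambda>y. L y a) (at x) h + frechet_derivative (\<lambda>y. L y b) (at x) h" for a b
    by (rule fun_cong[OF frechet_derivative_eqI, OF has_derivative_transform_within_open[OF
            has_derivative_add[OF D D] assms(1) x]]) (simp add: linear_add[OF lin])
  show "frechet_derivative (\<lambda>y. L y (r *\<^sub>R a)) (at x) h =
      r *\<^sub>R frechet_derivative (\<lambda>y. L y a) (at x) h" for r a
    by (rule fun_cong[OF frechet_derivative_eqI, OF has_derivative_transform_within_open[OF
            has_derivative_scaleR_right[OF D] assms(1) x]]) (simp add: linear_cmul[OF lin])
qed

lemma smooth_on_bilinear_family:
  fixes B :: "'a::real_normed_vector \<Rightarrow> 'e::euclidean_space \<Rightarrow> 'e \<Rightarrow> 'b::real_normed_vector"
  assumes "open V" "\<And>y. y \<in> V \<Longrightarrow> bilinear (B y)" "\<And>u v. smooth_on V (\<lambda>y. B y u v)"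
    and X: "smooth_on V X" and Y: "smooth_on V Y"
  shows "smooth_on V (\<lambda>y. B y (X y) (Y y))"
proof (rule smooth_on_linear_family[where L = "\<lambda>y. B y (X y)", OF assms(1) _ _ Y])
  show "smooth_on V (\<lambda>y. B y (X y) u)" for u
    by (rule smooth_on_linear_family[where L = "\<lambda>y w. B y w u", OF assms(1) _ _ X])
      (use assms(2,3) in \<open>auto simp: bilinear_def\<close>)
qed (use assms(2) in \<open>auto simp: bilinear_def\<close>)

text \<open>Constant directions have vanishing Lie bracket, so the curvature becomes the plain
  commutator of two such operators on fields.\<close>

abbreviation nabla where "nabla \<Gamma> u \<equiv> cov \<Gamma> (\<lambda>_. u)"

section \<open>Curvature as a commutator, and its symmetries\<close>

locale chart_connection =
  fixes V :: "'e::euclidean_space set" and \<Gamma> :: "'e \<Rightarrow> 'e \<Rightarrow> 'e \<Rightarrow> 'e"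
  assumes open_V: "open V"
    and bilinear_Gamma: "x \<in> V \<Longrightarrow> bilinear (\<Gamma> x)"
    and smooth_Gamma: "smooth_on V (\<lambda>x. \<Gamma> x u v)"
begin

lemma linear_Gamma: "x \<in> V \<Longrightarrow> linear (\<Gamma> x u)" "x \<in> V \<Longrightarrow> linear (\<lambda>u. \<Gamma> x u v)"
  using bilinear_Gamma by (auto simp: bilinear_def)

text \<open>The open set may be smaller than the chart; this allows differentiating an identity
  known only near \<open>x\<close>.\<close>

lemma nabla_cong:
  assumes "open W" "x \<in> W" "\<And>y. y \<in> W \<Longrightarrow> Y y = Z y"
  shows "nabla \<Gamma> u Y x = nabla \<Gamma> u Z x"
  using assms frechet_derivative_cong_open[OF assms] by (simp add: cov_def)

lemma smooth_on_nabla: "smooth_on V Y \<Longrightarrow> smooth_on V (nabla \<Gamma> u Y)"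
  unfolding cov_def
  using smooth_on_add[OF open_V smooth_on_frechet_derivative
      smooth_on_linear_family[OF open_V linear_Gamma(1) smooth_Gamma]] by blast

lemma nabla_add:
  assumes "smooth_on V Y" "smooth_on V Z" "x \<in> V"
  shows "nabla \<Gamma> u (\<lambda>y. Y y + Z y) x = nabla \<Gamma> u Y x + nabla \<Gamma> u Z x"
  unfolding cov_def
    frechet_derivative_smooth_add[OF assms]
  by (simp add: linear_add[OF linear_Gamma(1)[OF assms(3)]])

lemma nabla_diff:
  assumes "smooth_on V Y" "smooth_on V Z" "x \<in> V"
  shows "nabla \<Gamma> u (\<lambda>y. Y y - Z y) x = nabla \<Gamma> u Y x - nabla \<Gamma> u Z x"
  unfolding cov_def
    frechet_derivative_eqI[OF has_derivative_diff[OF assms(1,2)[THEN smooth_on_has_derivative, OF assms(3)]]]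
  by (simp add: linear_diff[OF linear_Gamma(1)[OF assms(3)]])

lemma nabla_scaleR:
  assumes f: "smooth_on V f" and Y: "smooth_on V Y" and x: "x \<in> V"
  shows "nabla \<Gamma> u (\<lambda>y. f y *\<^sub>R Y y) x =
    frechet_derivative f (at x) u *\<^sub>R Y x + f x *\<^sub>R nabla \<Gamma> u Y x"
  unfolding cov_def frechet_derivative_eqI[OF has_derivative_scaleR[OF
        smooth_on_has_derivative[OF f x] smooth_on_has_derivative[OF Y x]]]
  by (simp add: linear_cmul[OF linear_Gamma(1)[OF x]] algebra_simps)

lemma nabla_const [simp]: "nabla \<Gamma> u (\<lambda>_. w) x = \<Gamma> x u w"
  by (simp add: cov_def)

lemma nabla_nabla:
  assumes Y: "smooth_on V Y" and x: "x \<in> V"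
  shows "nabla \<Gamma> u (nabla \<Gamma> v Y) x = frechet_derivative (\<lambda>y. frechet_derivative Y (at y) v) (at x) u
    + frechet_derivative (\<lambda>y. \<Gamma> y v (Y x)) (at x) u
    + \<Gamma> x v (frechet_derivative Y (at x) u) + \<Gamma> x u (frechet_derivative Y (at x) v)
    + \<Gamma> x u (\<Gamma> x v (Y x))"
proof -
  have smooth: "smooth_on V (\<lambda>y. \<Gamma> y v (Y y))"
    by (rule smooth_on_linear_family[OF open_V linear_Gamma(1) smooth_Gamma Y])
  have "frechet_derivative (nabla \<Gamma> v Y) (at x) u =
      frechet_derivative (\<lambda>y. frechet_derivative Y (at y) v) (at x) u +
      frechet_derivative (\<lambda>y. \<Gamma> y v (Y y)) (at x) u"
    unfolding cov_def
    by (rule frechet_derivative_smooth_add[OF smooth_on_frechet_derivative[OF Y] smooth x])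
  then show ?thesis
    unfolding cov_def[of \<Gamma> "\<lambda>_. u"]
    by (simp add: frechet_derivative_linear_family[OF open_V linear_Gamma(1) smooth_Gamma Y x] x)
      (simp add: cov_def linear_add[OF linear_Gamma(1)[OF x]])
qed

lemma curvature_nabla_const:
  assumes x: "x \<in> V"
  shows "curvature \<Gamma> x u v w = nabla \<Gamma> u (nabla \<Gamma> v (\<lambda>_. w)) x - nabla \<Gamma> v (nabla \<Gamma> u (\<lambda>_. w)) x"
proof -
  have "lie_bracket (\<lambda>_. u) (\<lambda>_. v) = (\<lambda>_. 0)" by (simp add: lie_bracket_def fun_eq_iff)
  then show ?thesis
    using linear_0[OF linear_Gamma(2)[OF x]] by (simp add: curvature_def curvature_operator_def)
qed

lemma curvature_eq:
  assumes x: "x \<in> V"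
  shows "curvature \<Gamma> x u v w =
    frechet_derivative (\<lambda>y. \<Gamma> y v w) (at x) u - frechet_derivative (\<lambda>y. \<Gamma> y u w) (at x) v
    + \<Gamma> x u (\<Gamma> x v w) - \<Gamma> x v (\<Gamma> x u w)"
  using linear_0[OF linear_Gamma(1)[OF x]]
  by (simp only: curvature_nabla_const[OF x] nabla_nabla[OF smooth_on_const x]) simp

text \<open>In the commutator the second derivatives of \<open>Y\<close> cancel by symmetry and the
  terms with a first derivative of \<open>Y\<close> cancel in pairs. What remains depends on
  \<open>Y x\<close> only: this is tensoriality in the last argument.\<close>

lemma curvature_nabla:
  assumes Y: "smooth_on V Y" and x: "x \<in> V"
  shows "curvature \<Gamma> x u v (Y x) = nabla \<Gamma> u (nabla \<Gamma> v Y) x - nabla \<Gamma> v (nabla \<Gamma> u Y) x"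
  using symmetric_second_derivative[OF open_V Y x, of u v]
  by (simp add: nabla_nabla[OF Y x] curvature_eq[OF x])

lemma curvature_swap: "x \<in> V \<Longrightarrow> curvature \<Gamma> x v u w = - curvature \<Gamma> x u v w"
  by (simp add: curvature_nabla_const)

lemma linear_curvature:
  assumes x: "x \<in> V"
  shows "linear (\<lambda>u. curvature \<Gamma> x u v w)" "linear (\<lambda>v. curvature \<Gamma> x u v w)"
    "linear (\<lambda>w. curvature \<Gamma> x u v w)"
proof -
  note L = linear_Gamma[OF x]
  note D = linear_frechet_derivative_family[OF open_V linear_Gamma(1) smooth_Gamma x]
    linear_frechet_derivative_family[where L = "\<lambda>y u. \<Gamma> y u w" for w, OF open_V linear_Gamma(2) smooth_Gamma x]
    has_derivative_linear[OF smooth_on_has_derivative[OF smooth_Gamma x]]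
  note simps = curvature_eq[OF x] L[THEN linear_add] L[THEN linear_cmul] D[THEN linear_add] D[THEN linear_cmul]
  show 1: "linear (\<lambda>u. curvature \<Gamma> x u v w)" for v
    by (rule linearI) (simp_all add: simps algebra_simps)
  show "linear (\<lambda>v. curvature \<Gamma> x u v w)"
    using linear_compose_neg[OF 1[of u]] by (simp add: curvature_swap[OF x, of u])
  show "linear (\<lambda>w. curvature \<Gamma> x u v w)"
    by (rule linearI) (simp_all add: simps algebra_simps)
qed

text \<open>The second derivatives of the function \<open>g y w z\<close> commute. Expanded by the
  product rule, their mixed terms are symmetric in \<open>u\<close> and \<open>v\<close>, so only
  the two curvature terms survive.\<close>

lemma curvature_skew:
  assumes par: "parallel_form V \<Gamma> g" and bil: "\<And>x. x \<in> V \<Longrightarrow> bilinear (g x)"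
    and g: "\<And>u v. smooth_on V (\<lambda>x. g x u v)" and x: "x \<in> V"
  shows "g x (curvature \<Gamma> x u v w) z = - g x w (curvature \<Gamma> x u v z)"
proof -
  have D: "frechet_derivative (\<lambda>y. g y (Y y) (Z y)) (at y) a =
      g y (nabla \<Gamma> a Y y) (Z y) + g y (Y y) (nabla \<Gamma> a Z y)"
    if "smooth_on V Y" "smooth_on V Z" "y \<in> V" for Y Z y a
    using par[unfolded parallel_form_def, rule_format, OF smooth_on_const that, of a] by simp
  note sm = smooth_on_bilinear_family[OF open_V bil g]
  have DD: "frechet_derivative (\<lambda>y. frechet_derivative (\<lambda>y. g y w z) (at y) a) (at x) b =
      g x (nabla \<Gamma> b (nabla \<Gamma> a (\<lambda>_. w)) x) z + g x (nabla \<Gamma> a (\<lambda>_. w) x) (nabla \<Gamma> b (\<lambda>_. z) x)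
      + g x (nabla \<Gamma> b (\<lambda>_. w) x) (nabla \<Gamma> a (\<lambda>_. z) x) + g x w (nabla \<Gamma> b (nabla \<Gamma> a (\<lambda>_. z)) x)" for a b
  proof -
    have "frechet_derivative (\<lambda>y. frechet_derivative (\<lambda>y. g y w z) (at y) a) (at x) b =
        frechet_derivative (\<lambda>y. g y (nabla \<Gamma> a (\<lambda>_. w) y) z + g y w (nabla \<Gamma> a (\<lambda>_. z) y)) (at x) b"
      by (rule fun_cong[OF frechet_derivative_cong_open[OF open_V x]], rule D[OF smooth_on_const smooth_on_const])
    also have "\<dots> = frechet_derivative (\<lambda>y. g y (nabla \<Gamma> a (\<lambda>_. w) y) z) (at x) b
        + frechet_derivative (\<lambda>y. g y w (nabla \<Gamma> a (\<lambda>_. z) y)) (at x) b"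
      by (rule frechet_derivative_smooth_add[OF sm sm x]) (assumption | rule smooth_on_const smooth_on_nabla)+
    finally show ?thesis
      using D[OF smooth_on_nabla[OF smooth_on_const] smooth_on_const x, of a w z b]
        D[OF smooth_on_const smooth_on_nabla[OF smooth_on_const] x, of w a z b] by simp
  qed
  show ?thesis
    using symmetric_second_derivative[OF open_V g x, of w z u v] bil[OF x]
    by (simp add: DD curvature_nabla_const[OF x] bilinear_lsub bilinear_rsub)
qed

text \<open>A parallel \<open>J\<close> commutes with each \<open>nabla \<Gamma> u\<close>, hence
  with their commutator.\<close>

lemma curvature_endomorphism:
  assumes par: "parallel_endomorphism V \<Gamma> J" and lin: "\<And>x. x \<in> V \<Longrightarrow> linear (J x)"
    and J: "\<And>u. smooth_on V (\<lambda>x. J x u)" and x: "x \<in> V"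
  shows "curvature \<Gamma> x u v (J x w) = J x (curvature \<Gamma> x u v w)"
proof -
  have nJ: "nabla \<Gamma> a (\<lambda>y. J y (Y y)) y = J y (nabla \<Gamma> a Y y)" if "smooth_on V Y" "y \<in> V" for Y y a
    using par[unfolded parallel_endomorphism_def, rule_format, OF smooth_on_const that, of a] by simp
  have "nabla \<Gamma> a (nabla \<Gamma> b (\<lambda>y. J y w)) x = J x (nabla \<Gamma> a (nabla \<Gamma> b (\<lambda>_. w)) x)" for a b
  proof -
    have "nabla \<Gamma> a (nabla \<Gamma> b (\<lambda>y. J y w)) x = nabla \<Gamma> a (\<lambda>y. J y (nabla \<Gamma> b (\<lambda>_. w) y)) x"
      by (rule nabla_cong[OF open_V x]) (rule nJ[OF smooth_on_const])
    also have "\<dots> = J x (nabla \<Gamma> a (nabla \<Gamma> b (\<lambda>_. w)) x)"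
      by (rule nJ[OF smooth_on_nabla[OF smooth_on_const] x])
    finally show ?thesis .
  qed
  then show ?thesis
    unfolding curvature_nabla[OF J x] by (simp add: curvature_nabla_const[OF x] linear_diff[OF lin[OF x]])
qed

end

section \<open>Bianchi identities\<close>

locale torsion_free_chart_connection = chart_connection V \<Gamma>
  for V :: "'e::euclidean_space set" and \<Gamma> +
  assumes Gamma_commute: "x \<in> V \<Longrightarrow> \<Gamma> x u v = \<Gamma> x v u"
begin

text \<open>Symmetry of \<Gamma> lets the inner direction and the constant field trade places, after
  which the six second covariant derivatives cancel in pairs.\<close>

lemma first_Bianchi:
  assumes x: "x \<in> V"
  shows "curvature \<Gamma> x u v w + curvature \<Gamma> x v w u + curvature \<Gamma> x w u v = 0"
proof -
  have "nabla \<Gamma> a (nabla \<Gamma> b (\<lambda>_. c)) x = nabla \<Gamma> a (nabla \<Gamma> c (\<lambda>_. b)) x" for a b c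
    by (rule nabla_cong[OF open_V x]) (simp add: Gamma_commute)
  then show ?thesis by (simp add: curvature_nabla_const[OF x] algebra_simps)
qed

text \<open>This is the Jacobi identity for the commutators of the operators \<open>nabla \<Gamma> u\<close>; the terms
  in which the derivative falls on the first two arguments cancel because the torsion vanishes.\<close>

lemma second_Bianchi:
  fixes w :: 'e
  assumes x: "x \<in> V"
  defines "DR \<equiv> \<lambda>a u v. nabla \<Gamma> a (\<lambda>y. curvature \<Gamma> y u v w) x - curvature \<Gamma> x (\<Gamma> x a u) v w
    - curvature \<Gamma> x u (\<Gamma> x a v) w - curvature \<Gamma> x u v (\<Gamma> x a w)"
  shows "DR a u v + DR u v a + DR v a u = 0"
proof -
  note sm = smooth_on_nabla smooth_on_const
  have 1: "nabla \<Gamma> a (\<lambda>y. curvature \<Gamma> y u v w) x =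
      nabla \<Gamma> a (nabla \<Gamma> u (nabla \<Gamma> v (\<lambda>_. w))) x - nabla \<Gamma> a (nabla \<Gamma> v (nabla \<Gamma> u (\<lambda>_. w))) x" for a u v
  proof -
    have "nabla \<Gamma> a (\<lambda>y. curvature \<Gamma> y u v w) x =
        nabla \<Gamma> a (\<lambda>y. nabla \<Gamma> u (nabla \<Gamma> v (\<lambda>_. w)) y - nabla \<Gamma> v (nabla \<Gamma> u (\<lambda>_. w)) y) x"
      by (rule nabla_cong[OF open_V x]) (simp add: curvature_nabla_const)
    also have "\<dots> = nabla \<Gamma> a (nabla \<Gamma> u (nabla \<Gamma> v (\<lambda>_. w))) x - nabla \<Gamma> a (nabla \<Gamma> v (nabla \<Gamma> u (\<lambda>_. w))) x"
      by (intro nabla_diff sm x)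
    finally show ?thesis .
  qed
  have 2: "curvature \<Gamma> x u v (\<Gamma> x a w) =
      nabla \<Gamma> u (nabla \<Gamma> v (nabla \<Gamma> a (\<lambda>_. w))) x - nabla \<Gamma> v (nabla \<Gamma> u (nabla \<Gamma> a (\<lambda>_. w))) x" for a u v
    using curvature_nabla[OF smooth_on_nabla[OF smooth_on_const] x, of u v a w] by simp
  have 3: "curvature \<Gamma> x u (\<Gamma> x a v) w = - curvature \<Gamma> x (\<Gamma> x v a) u w" for a u v
    using curvature_swap[OF x] Gamma_commute[OF x] by metis
  show ?thesis unfolding DR_def 1 2 3 by simp
qed

end

text \<open>The octahedron argument: the cyclic identity is taken once for each choice of the vector
  in the last slot, and the two skew symmetries make the four relations combine.\<close>

lemma curvature_pair_symmetry:
  fixes Q :: "'a \<Rightarrow> 'a \<Rightarrow> 'a \<Rightarrow> 'a \<Rightarrow> real"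
  assumes "\<And>u v w z. Q v u w z = - Q u v w z" "\<And>u v w z. Q u v z w = - Q u v w z"
    and "\<And>u v w z. Q u v w z + Q v w u z + Q w u v z = 0"
  shows "Q u v w z = Q w z u v"
  using assms(3)[of u v w z] assms(3)[of v w z u] assms(3)[of w z u v] assms(3)[of z u v w]
    assms(1)[of u w] assms(1)[of v z] assms(2)
  by (smt (verit) assms(1))

section \<open>Structures of linear type\<close>

locale null_hermitian =
  fixes G :: "'e::euclidean_space \<Rightarrow> 'e \<Rightarrow> real" and I :: "'e \<Rightarrow> 'e" and \<epsilon> l :: real and a :: 'e
  assumes eps: "\<epsilon> * \<epsilon> = 1"
    and bilinear_G: "bilinear G" and G_commute: "G u v = G v u"
    and G_nondegenerate: "(\<And>v. G u v = 0) \<Longrightarrow> u = 0"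
    and linear_I: "linear I" and I_skew: "G (I u) v = - G u (I v)" and I_I: "I (I u) = \<epsilon> *\<^sub>R u"
    and null: "G a a = 0"
begin

text \<open>At a point, \<open>G\<close>, \<open>I\<close> and \<open>a\<close> are the values of \<open>g\<close>, \<open>J\<close> and \<open>\<xi>\<close>; the tensor of linear type
  is considered for any vector \<open>b\<close> in place of \<open>\<xi>\<close>, with \<open>l *\<^sub>R b\<close> in place of \<open>\<zeta>\<close>, because its
  covariant derivative is again of this form.\<close>

definition S_lin :: "'e \<Rightarrow> 'e \<Rightarrow> 'e \<Rightarrow> 'e" where
  "S_lin b u v = G u v *\<^sub>R b - G b v *\<^sub>R u + (\<epsilon> * G u (I v)) *\<^sub>R I b - (\<epsilon> * G b (I v)) *\<^sub>R I u
    - (2 * l * G b (I u)) *\<^sub>R I v"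

definition \<theta> where "\<theta> = G a"
definition \<phi> where "\<phi> = G (I a)"
definition F where "F u v = \<theta> u * \<phi> v - \<theta> v * \<phi> u"
definition k where "k = \<epsilon> + 2 * l"

lemmas G_linear = bilinear_ladd[OF bilinear_G] bilinear_radd[OF bilinear_G] bilinear_lsub[OF bilinear_G]
  bilinear_rsub[OF bilinear_G] bilinear_lmul[OF bilinear_G] bilinear_rmul[OF bilinear_G]
  bilinear_lneg[OF bilinear_G] bilinear_rneg[OF bilinear_G]
  bilinear_lzero[OF bilinear_G] bilinear_rzero[OF bilinear_G]

lemmas I_linear = linear_add[OF linear_I] linear_diff[OF linear_I] linear_cmul[OF linear_I]
  linear_neg[OF linear_I] linear_0[OF linear_I]

lemma G_theta: "G a u = \<theta> u" "G u a = \<theta> u" "G (I a) u = \<phi> u" "G u (I a) = \<phi> u"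
  by (simp_all add: \<theta>_def \<phi>_def G_commute)

lemma theta_simps:
  "\<theta> (u + v) = \<theta> u + \<theta> v" "\<theta> (u - v) = \<theta> u - \<theta> v" "\<theta> (r *\<^sub>R u) = r * \<theta> u" "\<theta> (- u) = - \<theta> u"
  "\<phi> (u + v) = \<phi> u + \<phi> v" "\<phi> (u - v) = \<phi> u - \<phi> v" "\<phi> (r *\<^sub>R u) = r * \<phi> u" "\<phi> (- u) = - \<phi> u"
  "\<theta> (I u) = - \<phi> u" "\<phi> (I u) = - \<epsilon> * \<theta> u"
  "\<theta> a = 0" "\<phi> a = 0" "\<theta> 0 = 0" "\<phi> 0 = 0"
proof -
  have "G a (I a) = 0" using I_skew[of a a] G_commute[of a "I a"] by simp
  then show "\<phi> a = 0" by (simp add: \<phi>_def I_skew)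
qed (simp_all add: \<theta>_def \<phi>_def G_linear I_skew I_I null)

lemma vector_eqI: "(\<And>v. G u v = G w v) \<Longrightarrow> u = w"
  using G_nondegenerate[of "u - w"] by (simp add: G_linear)

text \<open>This is where \<open>k\<close> originates: \<epsilon> comes from the term with
  \<open>G u (I v)\<close>, and \<open>2 * l\<close> from the last term, since
  \<open>\<theta> (I u) = - \<phi> u\<close>.\<close>

lemma S_null: "S_lin a u a = \<theta> u *\<^sub>R a + (k * \<phi> u) *\<^sub>R I a"
  by (simp add: S_lin_def G_theta theta_simps k_def algebra_simps)

lemma S_I_null: "S_lin a u (I a) = \<theta> u *\<^sub>R I a + (k * \<epsilon> * \<phi> u) *\<^sub>R a"
  using eps by (simp add: S_lin_def G_theta theta_simps I_I G_linear k_def algebra_simps)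

lemma S_null_left: "S_lin a a v = 0"
  by (simp add: S_lin_def G_theta theta_simps)

text \<open>The first two terms of \<open>S_lin\<close> are skew together, so are the next two, and
  the last is a multiple of the skew map \<open>I\<close>. Moving \<open>S_lin a u\<close> across
  \<open>G\<close> then yields \<open>\<theta>\<close> and \<open>\<phi>\<close> of its
  values.\<close>

lemma S_skew: "G (S_lin a u v) w = - G v (S_lin a u w)"
proof -
  have "G (I v) w = - G (I w) v" using I_skew[of v w] G_commute[of v "I w"] by simp
  moreover have "G v u = G u v" "G v (I u) = - G u (I v)"
    using G_commute[of v] I_skew[of u v] by auto
  ultimately show ?thesis
    by (simp add: S_lin_def G_linear G_theta theta_simps I_skew[of _ w] G_commute[of v "I w"] algebra_simps)
qed

lemma theta_S: "\<theta> (S_lin a u w) = - \<theta> u * \<theta> w - k * \<phi> u * \<phi> w"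
  using S_skew[of u a w] by (simp add: S_null G_linear G_theta)

lemma phi_S: "\<phi> (S_lin a u w) = - \<theta> u * \<phi> w - k * \<epsilon> * \<phi> u * \<theta> w"
  using S_skew[of u "I a" w] by (simp add: S_I_null G_linear G_theta)

lemma S_linear: "S_lin a u (v + w) = S_lin a u v + S_lin a u w" "S_lin a u (v - w) = S_lin a u v - S_lin a u w"
  "S_lin a u (r *\<^sub>R v) = r *\<^sub>R S_lin a u v"
  by (simp_all add: S_lin_def G_linear I_linear algebra_simps)

text \<open>It will be applied with the derivative of \<xi> as \<open>b\<close>. Testing at
  \<open>(a, a)\<close> gives \<open>\<phi> b = 0\<close>, testing at \<open>(a, w)\<close> puts
  \<open>b\<close> in the span of \<open>a\<close> and \<open>I a\<close>, and the last two
  coefficients are removed one at a time.\<close>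

lemma S_injective:
  assumes F: "F y z \<noteq> 0" and k: "k \<noteq> 0" and b: "\<theta> b = 0" and S: "\<And>u v. S_lin b u v = 0"
  shows "b = 0"
proof -
  have "\<theta> y \<noteq> 0 \<or> \<theta> z \<noteq> 0" and "a \<noteq> 0" "I a \<noteq> 0"
    using F by (auto simp: F_def \<theta>_def \<phi>_def G_linear I_linear)
  have "0 = S_lin b a a" using S by simp
  also have "\<dots> = (k * \<theta> (I b)) *\<^sub>R I a"
    using b by (simp add: S_lin_def G_theta theta_simps k_def algebra_simps)
  finally have pb: "\<phi> b = 0" using k \<open>I a \<noteq> 0\<close> by (simp add: theta_simps)
  \<comment> \<open>Cramer's rule for \<open>\<theta> w = 1\<close> and \<open>\<phi> w = 0\<close>
    in the span of \<open>y\<close> and \<open>z\<close>; the determinant is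
    \<open>F y z\<close>.\<close>
  define w where "w = (1 / F y z) *\<^sub>R (\<phi> z *\<^sub>R y - \<phi> y *\<^sub>R z)"
  have "\<phi> z * \<theta> y - \<phi> y * \<theta> z = F y z" by (simp add: F_def)
  then have w: "\<theta> w = 1" "\<phi> w = 0" using F by (simp_all add: w_def theta_simps)
  define p q where "p = G b w" and "q = \<epsilon> * G b (I w)"
  have "0 = S_lin b a w" using S by simp
  also have "\<dots> = b - p *\<^sub>R a - q *\<^sub>R I a"
    using b pb w by (simp add: S_lin_def G_theta theta_simps p_def q_def)
  finally have b_eq: "b = p *\<^sub>R a + q *\<^sub>R I a" by (simp add: algebra_simps)
  \<comment> \<open>Inserting the expansion of \<open>b\<close> into the definition of
    \<open>q\<close> gives \<open>q = - q\<close>, because \<epsilon> squares to 1.\<close>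
  have "G b (I w) = - \<epsilon> * q"
    by (subst b_eq) (simp add: G_linear G_theta theta_simps w)
  then have "q = \<epsilon> * (- \<epsilon> * q)" by (simp only: q_def)
  then have "q = 0" using eps by (simp flip: mult.assoc)
  with b_eq have b_eq: "b = p *\<^sub>R a" by simp
  have "p *\<^sub>R S_lin a w a = 0" using S[of w a] unfolding b_eq S_lin_def by (simp add: G_linear I_linear algebra_simps)
  then have "p *\<^sub>R a = 0" using w by (simp add: S_null)
  then show ?thesis by (simp add: b_eq)
qed

text \<open>If \<open>F\<close> vanished, nondegeneracy would make \<open>I a\<close> a real
  multiple \<open>r\<close> of \<open>a\<close> with \<open>r * r = \<epsilon>\<close>. This forces
  \<epsilon> = 1 and \<open>r\<close> to be 1 or -1, exactly the two excluded cases.\<close>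

lemma F_nonzero:
  assumes "I a \<noteq> a" "I a \<noteq> - a"
  shows "\<exists>y z. F y z \<noteq> 0"
proof (rule ccontr)
  assume "\<not> ?thesis"
  then have F: "F y z = 0" for y z by simp
  have "a \<noteq> 0" using assms I_linear by auto
  then obtain y where y: "\<theta> y \<noteq> 0" using G_nondegenerate[of a] by (auto simp: \<theta>_def)
  \<comment> \<open>The pairing of this vector with \<open>v\<close> is
    \<open>F y v\<close>.\<close>
  have "\<theta> y *\<^sub>R I a - \<phi> y *\<^sub>R a = 0"
    by (rule G_nondegenerate) (use F[of y] in \<open>simp add: F_def G_linear G_theta algebra_simps\<close>)
  define r where "r = \<phi> y / \<theta> y"
  have r: "I a = r *\<^sub>R a"
    using \<open>\<theta> y *\<^sub>R I a - \<phi> y *\<^sub>R a = 0\<close> y by (simp add: r_def eq_vector_fraction_iff)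
  have "(r * r) *\<^sub>R a = \<epsilon> *\<^sub>R a" using I_I[of a] by (simp only: r I_linear scaleR_scaleR)
  then have "\<epsilon> = r * r" using \<open>a \<noteq> 0\<close> by (metis scaleR_cancel_right)
  then have "r * r = 1 \<or> r * r = - 1" using eps by (simp only: square_eq_1_iff)
  then have "r * r = 1" using zero_le_square[of r] by auto
  then have "r = 1 \<or> r = - 1" by (simp add: square_eq_1_iff)
  then show False using r assms by auto
qed

text \<open>\<open>T x u v w\<close> stands for the covariant derivative of the curvature in
  direction \<open>x\<close>; the last assumption says that it is \<open>S_lin a x\<close> acting on
  \<open>R\<close> as a derivation.\<close>

lemma second_Bianchi_null:
  assumes lin: "\<And>v w. linear (\<lambda>u. R u v w)" "\<And>u w. linear (\<lambda>v. R u v w)" "\<And>u v. linear (\<lambda>w. R u v w)"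
    and swap: "\<And>u v w. R v u w = - R u v w"
    and pair: "\<And>u v w z. G (R u v w) z = G (R w z u) v"
    and R_I: "\<And>u v w. R u v (I w) = I (R u v w)"
    and R_null: "\<And>u v. R u v a = (c * F u v) *\<^sub>R I a"
    and cyclic: "\<And>u v w. T a u v w + T u v a w + T v a u w = 0"
    and T: "\<And>x u v w. T x u v w = S_lin a x (R u v w) - R (S_lin a x u) v w - R u (S_lin a x v) w - R u v (S_lin a x w)"
  shows "c * F y z = 0"
proof -
  \<comment> \<open>The endomorphism representing the 2-form \<open>F\<close> with respect to
    \<open>G\<close>.\<close>
  define P where "P w = \<theta> w *\<^sub>R I a - \<phi> w *\<^sub>R a" for w
  have G_P: "G (P w) z = F w z" for w z
    by (simp add: P_def F_def G_linear G_theta algebra_simps)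
  have R1: "R a v w = (c * \<phi> v) *\<^sub>R P w" for v w
    by (rule vector_eqI) (simp add: pair[of a] R_null G_linear G_theta G_P)
  have R2: "R (I a) v w = (c * \<epsilon> * \<theta> v) *\<^sub>R P w" for v w
    by (rule vector_eqI) (simp add: pair[of "I a"] R_null R_I I_linear I_I G_linear G_theta G_P)
  \<comment> \<open>\<open>P\<close> corresponds to the bivector of \<open>a\<close> and
    \<open>I a\<close>, whose plane \<open>S_lin a u\<close> preserves. The derivation acts on it by
    the trace on that plane, \<open>2 * \<theta> u\<close>; the terms with \<open>k\<close> are
    off-diagonal.\<close>
  have P_S: "S_lin a u (P w) - P (S_lin a u w) = (2 * \<theta> u) *\<^sub>R P w" for u w
    by (rule vector_eqI)
      (simp add: P_def S_linear S_null S_I_null theta_S phi_S G_linear G_theta algebra_simps)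
  have T1: "T u a v w = (2 * c * \<theta> u * \<phi> v) *\<^sub>R P w" for u v w
  proof -
    have "T u a v w = (c * \<phi> v) *\<^sub>R (S_lin a u (P w) - P (S_lin a u w))
        - (c * \<theta> u * \<phi> v + k * c * \<epsilon> * \<phi> u * \<theta> v + c * \<phi> (S_lin a u v)) *\<^sub>R P w"
      by (simp add: T R1 R2 S_null S_linear linear_add[OF lin(1)] linear_cmul[OF lin(1)] algebra_simps)
    also have "\<dots> = (2 * c * \<theta> u * \<phi> v) *\<^sub>R P w"
      unfolding P_S phi_S by (rule vector_eqI) (simp add: G_linear algebra_simps)
    finally show ?thesis .
  qed
  have T2: "T u v a w = - T u a v w" for u v w
    by (simp add: T swap[of a] swap[of "S_lin a u a"] S_linear(3)[of _ "-1", simplified])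
  have T3: "T a u v w = 0" for u v w
    by (simp add: T S_null_left linear_0[OF lin(1)] linear_0[OF lin(2)] linear_0[OF lin(3)])
  \<comment> \<open>Taking \<open>y\<close> also as last argument leaves \<open>P y\<close>, whose
    pairing with \<open>z\<close> is again \<open>F y z\<close>; the identity ends in a
    square.\<close>
  have "(2 * c * F y z) *\<^sub>R P y = 0"
    using cyclic[of y z y] by (auto simp add: T1 T2 T3 F_def algebra_simps)
  then have "G ((2 * c * F y z) *\<^sub>R P y) z = G 0 z" by (rule arg_cong)
  then show ?thesis by (simp only: G_linear G_P) simp
qed

end

section \<open>Covariant derivatives of expressions in a parallel metric\<close>

context chart_connection
begin

lemma frechet_derivative_parallel_form:
  assumes "parallel_form V \<Gamma> g" "smooth_on V Y" "smooth_on V Z" "x \<in> V"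
  shows "frechet_derivative (\<lambda>y. g y (Y y) (Z y)) (at x) u =
    g x (nabla \<Gamma> u Y x) (Z x) + g x (Y x) (nabla \<Gamma> u Z x)"
  using assms(1)[unfolded parallel_form_def, rule_format, OF smooth_on_const assms(2-4), of u] by simp

lemma nabla_parallel_endomorphism:
  assumes "parallel_endomorphism V \<Gamma> J" "smooth_on V Y" "x \<in> V"
  shows "nabla \<Gamma> u (\<lambda>y. J y (Y y)) x = J x (nabla \<Gamma> u Y x)"
  using assms(1)[unfolded parallel_endomorphism_def, rule_format, OF smooth_on_const assms(2,3), of u] by simp

text \<open>Every summand of a tensor of linear type, and of the formula for nabla \<xi>, has this
  shape, with \<open>r\<close> absorbing the constants.\<close>

lemma nabla_form_scaleR:
  assumes par: "parallel_form V \<Gamma> g" and bil: "\<And>x. x \<in> V \<Longrightarrow> bilinear (g x)"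
    and g: "\<And>u v. smooth_on V (\<lambda>x. g x u v)"
    and X: "smooth_on V X" and Y: "smooth_on V Y" and Z: "smooth_on V Z" and x: "x \<in> V"
  shows "nabla \<Gamma> u (\<lambda>y. (r * g y (X y) (Y y)) *\<^sub>R Z y) x =
    (r * (g x (nabla \<Gamma> u X x) (Y x) + g x (X x) (nabla \<Gamma> u Y x))) *\<^sub>R Z x
    + (r * g x (X x) (Y x)) *\<^sub>R nabla \<Gamma> u Z x"
proof -
  note smooth = smooth_on_bilinear_family[OF open_V bil g X Y]
  have "frechet_derivative (\<lambda>y. r * g y (X y) (Y y)) (at x) u = r * frechet_derivative (\<lambda>y. g y (X y) (Y y)) (at x) u"
    by (rule fun_cong[OF frechet_derivative_eqI])
      (rule has_derivative_mult_right[OF smooth_on_has_derivative[OF smooth x]])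
  then show ?thesis
    using nabla_scaleR[OF _ Z x, of "\<lambda>y. r * g y (X y) (Y y)" u]
      smooth_on_bilinear[OF open_V bounded_bilinear_mult smooth_on_const smooth, of r]
    by (simp add: frechet_derivative_parallel_form[OF par X Y x])
qed

lemma smooth_on_form_scaleR:
  fixes g :: "'e \<Rightarrow> 'e \<Rightarrow> 'e \<Rightarrow> real"
  assumes bil: "\<And>x. x \<in> V \<Longrightarrow> bilinear (g x)" and g: "\<And>u v. smooth_on V (\<lambda>x. g x u v)"
    and X: "smooth_on V X" and Y: "smooth_on V Y" and Z: "smooth_on V Z"
  shows "smooth_on V (\<lambda>y. (r * g y (X y) (Y y)) *\<^sub>R Z y)"
  using smooth_on_scaleR[OF open_V smooth_on_bilinear[OF open_V bounded_bilinear_mult smooth_on_const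
        smooth_on_bilinear_family[OF open_V bil g X Y]] Z] .

end

section \<open>The structure of linear type in one chart\<close>

locale null_linear_type_chart = torsion_free_chart_connection V \<Gamma>
  for V :: "'e::euclidean_space set" and \<Gamma> +
  fixes \<epsilon> l :: real and g :: "'e \<Rightarrow> 'e \<Rightarrow> 'e \<Rightarrow> real" and J :: "'e \<Rightarrow> 'e \<Rightarrow> 'e"
    and S :: "'e \<Rightarrow> 'e \<Rightarrow> 'e \<Rightarrow> 'e" and \<xi> :: "'e \<Rightarrow> 'e"
  assumes hermitian: "x \<in> V \<Longrightarrow> null_hermitian (g x) (J x) \<epsilon> (\<xi> x)"
    and smooth_g: "smooth_on V (\<lambda>x. g x u v)" and smooth_J: "smooth_on V (\<lambda>x. J x u)"
    and smooth_S: "smooth_on V (\<lambda>x. S x u v)" and smooth_xi: "smooth_on V \<xi>"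
    and S_eq: "x \<in> V \<Longrightarrow> S x u v = null_hermitian.S_lin (g x) (J x) \<epsilon> l (\<xi> x) u v"
    and parallel_g: "parallel_form V \<Gamma> g" and parallel_J: "parallel_endomorphism V \<Gamma> J"
    and parallel'_g: "parallel_form V (\<lambda>x u v. \<Gamma> x u v - S x u v) g"
    and parallel'_J: "parallel_endomorphism V (\<lambda>x u v. \<Gamma> x u v - S x u v) J"
    and parallel'_S: "parallel_1_2 V (\<lambda>x u v. \<Gamma> x u v - S x u v) S"
    and parallel'_R: "parallel_1_3 V (\<lambda>x u v. \<Gamma> x u v - S x u v) (curvature \<Gamma>)"
begin

abbreviation \<Gamma>' where "\<Gamma>' \<equiv> \<lambda>x u v. \<Gamma> x u v - S x u v"

lemma bilinear_g: "x \<in> V \<Longrightarrow> bilinear (g x)" and linear_J: "x \<in> V \<Longrightarrow> linear (J x)"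
  using hermitian null_hermitian.bilinear_G null_hermitian.linear_I by blast+

lemma bilinear_S:
  assumes "x \<in> V"
  shows "bilinear (S x)"
proof -
  interpret null_hermitian "g x" "J x" \<epsilon> l "\<xi> x" by (rule hermitian[OF assms])
  show ?thesis
    unfolding bilinear_def S_eq[OF assms] S_lin_def
    by (intro conjI allI linearI) (simp_all add: G_linear I_linear algebra_simps)
qed

text \<open>Only the general calculus transfers: nabla - S has torsion
  \<open>S x v u - S x u v\<close>, so the Bianchi identities are kept for
  \<open>\<Gamma>\<close>.\<close>

sublocale tilde: chart_connection V \<Gamma>'
proof
  show "bilinear (\<Gamma>' x)" if "x \<in> V" for x
    using bilinear_Gamma[OF that] bilinear_S[OF that]
    by (simp add: bilinear_def linear_compose_sub)
qed (rule open_V, rule smooth_on_diff[OF open_V smooth_Gamma smooth_S])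

lemma nabla_eq_tilde: "nabla \<Gamma> u Y x = nabla \<Gamma>' u Y x + S x u (Y x)"
  by (simp add: cov_def)

lemma smooth_J_xi: "smooth_on V (\<lambda>y. J y (\<xi> y))"
  by (rule smooth_on_linear_family[OF open_V linear_J smooth_J smooth_xi])

lemma smooth_on_g_scaleR:
  "smooth_on V X \<Longrightarrow> smooth_on V Y \<Longrightarrow> smooth_on V Z \<Longrightarrow> smooth_on V (\<lambda>y. (r * g y (X y) (Y y)) *\<^sub>R Z y)"
  by (rule smooth_on_form_scaleR[OF bilinear_g smooth_g])

lemma nabla_g_scaleR:
  assumes "smooth_on V X" "smooth_on V Y" "smooth_on V Z" "x \<in> V"
  shows "nabla \<Gamma> u (\<lambda>y. (r * g y (X y) (Y y)) *\<^sub>R Z y) x =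
      (r * (g x (nabla \<Gamma> u X x) (Y x) + g x (X x) (nabla \<Gamma> u Y x))) *\<^sub>R Z x
      + (r * g x (X x) (Y x)) *\<^sub>R nabla \<Gamma> u Z x"
    and "nabla \<Gamma>' u (\<lambda>y. (r * g y (X y) (Y y)) *\<^sub>R Z y) x =
      (r * (g x (nabla \<Gamma>' u X x) (Y x) + g x (X x) (nabla \<Gamma>' u Y x))) *\<^sub>R Z x
      + (r * g x (X x) (Y x)) *\<^sub>R nabla \<Gamma>' u Z x"
  by (rule nabla_form_scaleR[where g = g, OF parallel_g bilinear_g smooth_g assms], assumption)
    (rule tilde.nabla_form_scaleR[where g = g, OF parallel'_g bilinear_g smooth_g assms], assumption)

text \<open>Since \<open>g\<close> and \<open>J\<close> are parallel for nabla - S, differentiating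
  \<open>S\<close> only replaces \<xi> by its derivative, and \<open>S\<close> itself is
  parallel.\<close>

lemma tilde_nabla_S:
  assumes x: "x \<in> V"
  shows "null_hermitian.S_lin (g x) (J x) \<epsilon> l (nabla \<Gamma>' u \<xi> x) v z = 0"
proof -
  interpret null_hermitian "g x" "J x" \<epsilon> l "\<xi> x" by (rule hermitian[OF x])
  note smooth = smooth_on_const smooth_xi smooth_J_xi smooth_J
  note s = smooth_on_g_scaleR and T = nabla_g_scaleR(2)[OF _ _ _ x]
  have J: "nabla \<Gamma>' u (\<lambda>y. J y w) x = J x (\<Gamma>' x u w)" for w
    using tilde.nabla_parallel_endomorphism[OF parallel'_J smooth_on_const x, of u w] by simp
  have J\<xi>: "nabla \<Gamma>' u (\<lambda>y. J y (\<xi> y)) x = J x (nabla \<Gamma>' u \<xi> x)"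
    by (rule tilde.nabla_parallel_endomorphism[OF parallel'_J smooth_xi x])
  have "S x (\<Gamma>' x u v) z + S x v (\<Gamma>' x u z) = nabla \<Gamma>' u (\<lambda>y. S y v z) x"
    using parallel'_S[unfolded parallel_1_2_def, rule_format,
        OF smooth_on_const smooth_on_const smooth_on_const x, of u v z] by (simp add: algebra_simps)
  \<comment> \<open>The factors 1 give all five summands the shape required by
    \<open>nabla_g_scaleR\<close>.\<close>
  also have "\<dots> = nabla \<Gamma>' u (\<lambda>y. (1 * g y v z) *\<^sub>R \<xi> y - (1 * g y (\<xi> y) z) *\<^sub>R v
      + (\<epsilon> * g y v (J y z)) *\<^sub>R J y (\<xi> y) - (\<epsilon> * g y (\<xi> y) (J y z)) *\<^sub>R J y v
      - ((2 * l) * g y (\<xi> y) (J y v)) *\<^sub>R J y z) x"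
    by (rule tilde.nabla_cong[OF open_V x]) (simp add: S_eq null_hermitian.S_lin_def[OF hermitian])
  also have "\<dots> = nabla \<Gamma>' u (\<lambda>y. (1 * g y v z) *\<^sub>R \<xi> y) x - nabla \<Gamma>' u (\<lambda>y. (1 * g y (\<xi> y) z) *\<^sub>R v) x
      + nabla \<Gamma>' u (\<lambda>y. (\<epsilon> * g y v (J y z)) *\<^sub>R J y (\<xi> y)) x
      - nabla \<Gamma>' u (\<lambda>y. (\<epsilon> * g y (\<xi> y) (J y z)) *\<^sub>R J y v) x
      - nabla \<Gamma>' u (\<lambda>y. ((2 * l) * g y (\<xi> y) (J y v)) *\<^sub>R J y z) x"
    using s[OF smooth(1) smooth(1) smooth(2), of 1 v z] s[OF smooth(2) smooth(1) smooth(1), of 1 z v]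
      s[OF smooth(1) smooth(4) smooth(3), of \<epsilon> v z] s[OF smooth(2) smooth(4) smooth(4), of \<epsilon> z v]
      s[OF smooth(2) smooth(4) smooth(4), of "2 * l" v z]
    by (simp only: tilde.nabla_add[OF _ _ x] tilde.nabla_diff[OF _ _ x] smooth_on_add[OF open_V]
        smooth_on_diff[OF open_V])
  also have "\<dots> = null_hermitian.S_lin (g x) (J x) \<epsilon> l (nabla \<Gamma>' u \<xi> x) v z
      + S x (\<Gamma>' x u v) z + S x v (\<Gamma>' x u z)"
    unfolding S_eq[OF x] S_lin_def T[OF smooth(1) smooth(1) smooth(2)] T[OF smooth(2) smooth(1) smooth(1)]
      T[OF smooth(1) smooth(4) smooth(3)] T[OF smooth(2) smooth(4) smooth(4)] J J\<xi> tilde.nabla_const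
    by (simp add: algebra_simps G_linear I_linear)
  finally show ?thesis by simp
qed

lemma nabla_xi:
  assumes x: "x \<in> V" and F: "null_hermitian.F (g x) (J x) (\<xi> x) y z \<noteq> 0" and l: "\<epsilon> + 2 * l \<noteq> 0"
  shows "nabla \<Gamma> u \<xi> x = g x (\<xi> x) u *\<^sub>R \<xi> x + ((\<epsilon> + 2 * l) * g x (J x (\<xi> x)) u) *\<^sub>R J x (\<xi> x)"
proof -
  interpret null_hermitian "g x" "J x" \<epsilon> l "\<xi> x" by (rule hermitian[OF x])
  \<comment> \<open>Differentiating the null condition with a metric connection supplies the
    orthogonality \<open>\<theta> b = 0\<close> for \<open>S_injective\<close>.\<close>
  have "frechet_derivative (\<lambda>y. g y (\<xi> y) (\<xi> y)) (at x) = frechet_derivative (\<lambda>y. 0) (at x)"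
    by (rule frechet_derivative_cong_open[OF open_V x]) (rule null_hermitian.null[OF hermitian])
  then have "\<theta> (nabla \<Gamma>' u \<xi> x) = 0"
    using tilde.frechet_derivative_parallel_form[OF parallel'_g smooth_xi smooth_xi x, of u]
    by (simp add: G_theta)
  then have "nabla \<Gamma>' u \<xi> x = 0"
    using S_injective[OF F] l tilde_nabla_S[OF x] by (simp add: k_def)
  then show ?thesis
    by (simp add: nabla_eq_tilde S_eq[OF x] S_null \<theta>_def \<phi>_def k_def)
qed

lemma curvature_xi:
  assumes x: "x \<in> V" and F: "null_hermitian.F (g x) (J x) (\<xi> x) y z \<noteq> 0" and l: "\<epsilon> + 2 * l \<noteq> 0"
  shows "curvature \<Gamma> x u v (\<xi> x) =
    (- 2 * l * \<epsilon> * (\<epsilon> + 2 * l) * null_hermitian.F (g x) (J x) (\<xi> x) u v) *\<^sub>R J x (\<xi> x)"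
proof -
  interpret null_hermitian "g x" "J x" \<epsilon> l "\<xi> x" by (rule hermitian[OF x])
  define f where "f p = g p (\<xi> p) y * g p (J p (\<xi> p)) z - g p (\<xi> p) z * g p (J p (\<xi> p)) y" for p
  have f: "f p = null_hermitian.F (g p) (J p) (\<xi> p) y z" if "p \<in> V" for p
  proof -
    interpret p: null_hermitian "g p" "J p" \<epsilon> l "\<xi> p" by (rule hermitian[OF that])
    show ?thesis by (simp add: f_def p.F_def p.\<theta>_def p.\<phi>_def)
  qed
  \<comment> \<open>On this neighbourhood the formula of \<open>nabla_xi\<close> is an identity of
    fields and can be differentiated once more.\<close>
  define W where "W = {p \<in> V. f p \<noteq> 0}"
  have sm: "smooth_on V (\<lambda>p. g p (Y p) (Z p))" if "smooth_on V Y" "smooth_on V Z" for Y Z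
    using smooth_on_bilinear_family[OF open_V bilinear_g smooth_g that] .
  have "continuous_on V f"
    unfolding f_def using sm[OF smooth_xi smooth_on_const] sm[OF smooth_J_xi smooth_on_const]
    by (intro continuous_intros smooth_on_continuous_on)
  then have "open W"
    using continuous_open_preimage[of V f "- {0}"] open_V by (simp add: W_def vimage_def Int_def open_Compl)
  have "x \<in> W" using x F f by (simp add: W_def)
  note s = smooth_on_g_scaleR and T = nabla_g_scaleR(1)[OF _ _ _ x]
  have n: "nabla \<Gamma> a \<xi> x = \<theta> a *\<^sub>R \<xi> x + (k * \<phi> a) *\<^sub>R J x (\<xi> x)" for a
    using nabla_xi[OF x F l] by (simp add: \<theta>_def \<phi>_def k_def)
  have nJ: "nabla \<Gamma> a (\<lambda>y. J y (\<xi> y)) x = \<theta> a *\<^sub>R J x (\<xi> x) + (k * \<epsilon> * \<phi> a) *\<^sub>R \<xi> x" for a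
    by (simp add: nabla_parallel_endomorphism[OF parallel_J smooth_xi x] n I_linear I_I algebra_simps)
  have nn: "nabla \<Gamma> a (nabla \<Gamma> b \<xi>) x =
      (g x (nabla \<Gamma> a \<xi> x) b + \<theta> (\<Gamma> x a b)) *\<^sub>R \<xi> x + \<theta> b *\<^sub>R nabla \<Gamma> a \<xi> x
      + (k * (g x (nabla \<Gamma> a (\<lambda>y. J y (\<xi> y)) x) b + \<phi> (\<Gamma> x a b))) *\<^sub>R J x (\<xi> x)
      + (k * \<phi> b) *\<^sub>R nabla \<Gamma> a (\<lambda>y. J y (\<xi> y)) x" for a b
  proof -
    have "nabla \<Gamma> a (nabla \<Gamma> b \<xi>) x = nabla \<Gamma> a (\<lambda>y. (1 * g y (\<xi> y) b) *\<^sub>R \<xi> y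
        + (k * g y (J y (\<xi> y)) b) *\<^sub>R J y (\<xi> y)) x"
    proof (rule nabla_cong[OF \<open>open W\<close> \<open>x \<in> W\<close>])
      fix p assume "p \<in> W"
      then have "p \<in> V" "null_hermitian.F (g p) (J p) (\<xi> p) y z \<noteq> 0" using f by (auto simp: W_def)
      then show "nabla \<Gamma> b \<xi> p = (1 * g p (\<xi> p) b) *\<^sub>R \<xi> p + (k * g p (J p (\<xi> p)) b) *\<^sub>R J p (\<xi> p)"
        using nabla_xi[OF _ _ l] by (simp add: k_def)
    qed
    also have "\<dots> = nabla \<Gamma> a (\<lambda>y. (1 * g y (\<xi> y) b) *\<^sub>R \<xi> y) x
        + nabla \<Gamma> a (\<lambda>y. (k * g y (J y (\<xi> y)) b) *\<^sub>R J y (\<xi> y)) x"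
      by (rule nabla_add[OF s[OF smooth_xi smooth_on_const smooth_xi]
            s[OF smooth_J_xi smooth_on_const smooth_J_xi] x])
    finally show ?thesis
      unfolding T[OF smooth_xi smooth_on_const smooth_xi] T[OF smooth_J_xi smooth_on_const smooth_J_xi]
      by (simp add: \<theta>_def \<phi>_def)
  qed
  \<comment> \<open>In the commutator the contributions \<open>- k * F u v\<close> and
    \<open>k * F u v\<close> cancel; the derivative of \<open>\<phi>\<close> leaves
    \<open>k * (1 - k * \<epsilon>)\<close>, rewritten here in terms of \<open>l\<close>.\<close>
  have "1 - k * \<epsilon> = - 2 * l * \<epsilon>" using eps by (simp add: k_def algebra_simps)
  then have c: "- 2 * l * \<epsilon> * (\<epsilon> + 2 * l) = k * (1 - k * \<epsilon>)" by (simp only: k_def mult_ac)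
  show ?thesis
    unfolding curvature_nabla[OF smooth_xi x] nn n nJ c
    by (rule vector_eqI)
      (simp add: F_def G_linear G_theta Gamma_commute[OF x, of v u] algebra_simps)
qed

lemma lambda_values:
  assumes x: "x \<in> V" and F: "null_hermitian.F (g x) (J x) (\<xi> x) y z \<noteq> 0"
  shows "l = 0 \<or> \<epsilon> + 2 * l = 0"
proof (rule ccontr)
  assume "\<not> ?thesis"
  then have l: "\<epsilon> + 2 * l \<noteq> 0" "l \<noteq> 0" by auto
  interpret null_hermitian "g x" "J x" \<epsilon> l "\<xi> x" by (rule hermitian[OF x])
  define R where "R = curvature \<Gamma> x"
  define T where "T a u v w = nabla \<Gamma> a (\<lambda>y. curvature \<Gamma> y u v w) x - R (\<Gamma> x a u) v w
    - R u (\<Gamma> x a v) w - R u v (\<Gamma> x a w)" for a u v w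
  have R_skew: "g x (R u v w) z = - g x w (R u v z)" for u v w z
    unfolding R_def by (rule curvature_skew[where g = g, OF parallel_g bilinear_g smooth_g x])
  have R_swap: "R v u w = - R u v w" for u v w
    unfolding R_def by (rule curvature_swap[OF x])
  have R_pair: "g x (R u v w) z = g x (R w z u) v" for u v w z
  proof (rule curvature_pair_symmetry[where Q = "\<lambda>u v w z. g x (R u v w) z"])
    fix u v w z
    show "g x (R v u w) z = - g x (R u v w) z"
      by (subst R_swap) (simp only: G_linear)
    show "g x (R u v z) w = - g x (R u v w) z"
      using R_skew[of u v z w] G_commute[of z "R u v w"] by simp
    have "g x (R u v w + R v w u + R w u v) z = g x 0 z"
      unfolding R_def first_Bianchi[OF x] ..
    then show "g x (R u v w) z + g x (R v w u) z + g x (R w u v) z = 0"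
      by (simp only: G_linear)
  qed
  note lin = linear_curvature[OF x, folded R_def]
  have "(- 2 * l * \<epsilon> * (\<epsilon> + 2 * l)) * F y z = 0"
  proof (rule second_Bianchi_null[of R])
    show "R v u w = - R u v w" "g x (R u v w) z = g x (R w z u) v" for u v w z
      by (rule R_swap, rule R_pair)
    show "R u v (J x w) = J x (R u v w)" for u v w
      unfolding R_def by (rule curvature_endomorphism[OF parallel_J linear_J smooth_J x])
    show "R u v (\<xi> x) = (- 2 * l * \<epsilon> * (\<epsilon> + 2 * l) * F u v) *\<^sub>R J x (\<xi> x)" for u v
      unfolding R_def by (rule curvature_xi[OF x F l(1)])
    show "T (\<xi> x) u v w + T u v (\<xi> x) w + T v (\<xi> x) u w = 0" for u v w
      unfolding T_def R_def by (rule second_Bianchi[OF x])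
    \<comment> \<open>Each derivative for \<open>\<Gamma>\<close> is one for
      \<open>\<Gamma>'\<close> plus a term in \<open>S\<close>; the \<open>\<Gamma>'\<close> parts
      add up to zero because the curvature is parallel for nabla - S.\<close>
    show "T a u v w = S_lin (\<xi> x) a (R u v w) - R (S_lin (\<xi> x) a u) v w - R u (S_lin (\<xi> x) a v) w
        - R u v (S_lin (\<xi> x) a w)" for a u v w
      using parallel'_R[unfolded parallel_1_3_def, rule_format,
          OF smooth_on_const smooth_on_const smooth_on_const smooth_on_const x, of a u v w]
      unfolding T_def nabla_eq_tilde R_def[symmetric] tilde.nabla_const S_eq[OF x]
      by (simp add: lin[THEN linear_diff] algebra_simps)
  qed (fact lin)+
  then show False using l F eps by auto
qed

end

section \<open>From the manifold to one chart\<close>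

theorem corollary3p4:
  fixes M :: "'m topology"
    and A :: "('m, 'e::euclidean_space) chart set"
    and g :: "('m, 'e) chart \<Rightarrow> 'e \<Rightarrow> 'e \<Rightarrow> 'e \<Rightarrow> real"
    and J :: "('m, 'e) chart \<Rightarrow> 'e \<Rightarrow> 'e \<Rightarrow> 'e"
    and \<Gamma> S :: "('m, 'e) chart \<Rightarrow> 'e \<Rightarrow> 'e \<Rightarrow> 'e \<Rightarrow> 'e"
    and \<xi> \<zeta> :: "('m, 'e) chart \<Rightarrow> 'e \<Rightarrow> 'e"
    and \<epsilon> l :: real
  assumes "\<epsilon> \<in> {-1, 1}"
    and "connected_space M"
    and "DIM('e) \<ge> 4"
    and "eps_kaehler \<epsilon> M A g J \<Gamma>"
    and "homogeneous_eps_kaehler_structure A g J \<Gamma> S"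
    and "linear_type \<epsilon> A g J S \<xi> \<zeta>"
    and "degenerate A g \<xi>"
    and "\<forall>c\<in>A. \<forall>x\<in>chart_image c. \<zeta> c x = l *\<^sub>R \<xi> c x"
    and "\<not> J_eigenfield A J \<xi>"
  shows "l = 0 \<or> l = - \<epsilon> / 2"
proof -
  \<comment> \<open>Both inequalities hold at the same point, and together they also force \<xi> to
    be nonzero there.\<close>
  obtain c x where c: "c \<in> A" and x: "x \<in> chart_image c"
    and J\<xi>: "J c x (\<xi> c x) \<noteq> \<xi> c x" "J c x (\<xi> c x) \<noteq> - \<xi> c x"
    using assms(9) unfolding J_eigenfield_def by blast
  define V where "V = chart_image c"
  have M: "smooth_manifold M A" and gA: "bilinear_form_field A g"
    and gV: "\<forall>c\<in>A. \<forall>x\<in>chart_image c.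
      (\<forall>u v. g c x u v = g c x v u) \<and> (\<forall>u. (\<forall>v. g c x u v = 0) \<longrightarrow> u = 0)"
    and GammaA: "connection A \<Gamma>"
    and GammaV: "\<forall>c\<in>A. torsion_free (chart_image c) (\<Gamma> c) \<and> parallel_form (chart_image c) (\<Gamma> c) (g c)"
    and JA: "endomorphism_field A J"
    and JV: "\<forall>c\<in>A. \<forall>x\<in>chart_image c.
      (\<forall>u v. g c x (J c x u) v = - g c x u (J c x v)) \<and> (\<forall>u. J c x (J c x u) = \<epsilon> *\<^sub>R u)"
    and parallel_J: "\<forall>c\<in>A. parallel_endomorphism (chart_image c) (\<Gamma> c) (J c)"
    using assms(4) unfolding eps_kaehler_def pseudo_riemannian_def levi_civita_def by - (elim conjE, assumption)+
  have SA: "tensor_field_1_2 A S"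
    and SV: "\<forall>c\<in>A. let V = chart_image c; \<Gamma>' = (\<lambda>x u v. \<Gamma> c x u v - S c x u v) in
        parallel_form V \<Gamma>' (g c) \<and> parallel_1_3 V \<Gamma>' (curvature (\<Gamma> c)) \<and>
        parallel_1_2 V \<Gamma>' (S c) \<and> parallel_endomorphism V \<Gamma>' (J c)"
    using assms(5) unfolding homogeneous_eps_kaehler_structure_def by - (elim conjE, assumption)+
  have "open V"
    using M c by (simp add: V_def smooth_manifold_def)
  have Gamma: "bilinear (\<Gamma> c y)" if "y \<in> V" for y
    using GammaA c that by (simp add: connection_def V_def)
  have smooth_Gamma: "smooth_on V (\<lambda>y. \<Gamma> c y u v)" for u v
    using GammaA c by (simp add: connection_def V_def)
  have g: "bilinear (g c y)" "g c y u v = g c y v u" if "y \<in> V" for y u v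
    using gA gV c that by (simp_all add: bilinear_form_field_def V_def)
  have nondegenerate: "u = 0" if "y \<in> V" "\<And>v. g c y u v = 0" for y u
    using gV c that by (simp add: V_def)
  have smooth_g: "smooth_on V (\<lambda>y. g c y u v)" for u v
    using gA c by (simp add: bilinear_form_field_def V_def)
  have J: "linear (J c y)" "g c y (J c y u) v = - g c y u (J c y v)"
    "J c y (J c y u) = \<epsilon> *\<^sub>R u" if "y \<in> V" for y u v
    using JA JV c that by (simp_all add: endomorphism_field_def V_def)
  have smooth_J: "smooth_on V (\<lambda>y. J c y u)" for u
    using JA c by (simp add: endomorphism_field_def V_def)
  have smooth_S: "smooth_on V (\<lambda>y. S c y u v)" for u v
    using SA c by (simp add: tensor_field_1_2_def V_def)
  have smooth_xi: "smooth_on V (\<xi> c)"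
    using assms(6) c by (simp add: linear_type_def vector_field_def V_def)
  have torsion: "\<Gamma> c y u v = \<Gamma> c y v u" if "y \<in> V" for y u v
  proof -
    have "torsion_free V (\<Gamma> c)" using GammaV c by (simp add: V_def)
    from this[unfolded torsion_free_def, rule_format, OF smooth_on_const smooth_on_const that, of u v]
    show ?thesis by (simp add: lie_bracket_def cov_def)
  qed
  have eps: "\<epsilon> * \<epsilon> = 1" using assms(1) by auto
  have hermitian: "null_hermitian (g c y) (J c y) \<epsilon> (\<xi> c y)" if "y \<in> V" for y
  proof (rule null_hermitian.intro)
    show "g c y (\<xi> c y) (\<xi> c y) = 0" using assms(7) c that by (simp add: degenerate_def V_def)
  qed (fact eps g(1)[OF that] g(2)[OF that] J(1)[OF that] J(2)[OF that] J(3)[OF that]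
      | rule nondegenerate[OF that], assumption)+
  have "null_linear_type_chart V (\<Gamma> c) \<epsilon> l (g c) (J c) (S c) (\<xi> c)"
  proof (intro null_linear_type_chart.intro torsion_free_chart_connection.intro
      torsion_free_chart_connection_axioms.intro chart_connection.intro null_linear_type_chart_axioms.intro)
    show "S c y u v = null_hermitian.S_lin (g c y) (J c y) \<epsilon> l (\<xi> c y) u v" if "y \<in> V" for y u v
      using assms(6)[unfolded linear_type_def] assms(8) c that bilinear_lmul[OF g(1)[OF that]]
      by (simp add: null_hermitian.S_lin_def[OF hermitian[OF that]] V_def Let_def)
    show "parallel_form V (\<Gamma> c) (g c)" "parallel_endomorphism V (\<Gamma> c) (J c)"
      using GammaV parallel_J c by (simp_all add: V_def)
    show "parallel_form V (\<lambda>x u v. \<Gamma> c x u v - S c x u v) (g c)"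
      "parallel_endomorphism V (\<lambda>x u v. \<Gamma> c x u v - S c x u v) (J c)"
      "parallel_1_2 V (\<lambda>x u v. \<Gamma> c x u v - S c x u v) (S c)"
      "parallel_1_3 V (\<lambda>x u v. \<Gamma> c x u v - S c x u v) (curvature (\<Gamma> c))"
      using SV c by (simp_all add: V_def Let_def)
  qed (fact \<open>open V\<close> smooth_Gamma smooth_g smooth_J smooth_S smooth_xi
      | rule Gamma torsion hermitian, assumption)+
  then interpret null_linear_type_chart V "\<Gamma> c" \<epsilon> l "g c" "J c" "S c" "\<xi> c" .
  obtain y z where "null_hermitian.F (g c x) (J c x) (\<xi> c x) y z \<noteq> 0"
    using null_hermitian.F_nonzero[OF hermitian J\<xi>] x by (auto simp: V_def)
  then show ?thesis using lambda_values x by (auto simp: V_def)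
qed

end
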